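(* There exists a family (set) $\mathcal{H}$ of pairwise non-embeddable torsion-free groups such that for every infinite cardinal number $\kappa\leq\mathbf{b}_{\omega_1}$ the family $\mathcal{H}$ contains $2^\kappa$ groups of order $\kappa$.
   Context: $\mathbf{b}_\alpha$ denotes the $\alpha$th beth number: $\mathbf{b}_0=\aleph_0$ and $\mathbf{b}_\alpha=\sup\{2^{\mathbf{b}_\beta} \mid \beta<\alpha\}$ for every ordinal $\alpha>0$. $\omega_1$ is the first uncountable ordinal. The order of a group $G$ is the cardinality $|G|$. A family of groups is pairwise non-embeddable if for any two distinct members $G,H$ of the family (of equal or different orders) there is no injective group homomorphism from $G$ to $H$. Groups are not assumed abelian. *)

theory Defs
  imports "HOL-Algebra.Group"
begin

unbundle cardinal_syntax

section \<open>Torsion-free groups\<close>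

definition torsion_free :: "('a, 'b) monoid_scheme \<Rightarrow> bool" where
  "torsion_free G \<longleftrightarrow>
     (\<forall>x\<in>carrier G. \<forall>n::nat. n > 0 \<and> x [^]\<^bsub>G\<^esub> n = \<one>\<^bsub>G\<^esub> \<longrightarrow> x = \<one>\<^bsub>G\<^esub>)"

section \<open>Beth numbers\<close>

text \<open>Cardinals are cardinal orders, compared up to \<open>=o\<close>; an ordinal is represented by
  an arbitrary well-order.\<close>

text \<open>It suffices to compare \<open>b\<close> with upper bounds on the same type: a smaller
  upper bound on another type would have an isomorphic copy on the type of \<open>b\<close>.\<close>

definition is_card_sup :: "'b rel set \<Rightarrow> 'a rel \<Rightarrow> bool" where
  "is_card_sup S b \<longleftrightarrow> Card_order b \<and> (\<forall>c\<in>S. c \<le>o b) \<and>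
     (\<forall>d :: 'a rel. Card_order d \<and> (\<forall>c\<in>S. c \<le>o d) \<longrightarrow> b \<le>o d)"

text \<open>\<open>beth_value S b\<close>: \<open>b\<close> is the beth number at an ordinal at whose predecessors the
  beth numbers are the members of \<open>S\<close>.\<close>

definition beth_value :: "'a rel set \<Rightarrow> 'a rel \<Rightarrow> bool" where
  "beth_value S b \<longleftrightarrow>
     (if S = {} then Card_order b \<and> b =o natLeq else is_card_sup ((\<lambda>c. ctwo ^c c) ` S) b)"

text \<open>Transfinite recursion along \<open>\<alpha>\<close>: an element \<open>i\<close> of \<open>Field \<alpha>\<close> stands for the order type
  of its strict predecessors, and \<open>f i\<close> is the beth number there. Since a large beth number
  need not have a representative on the type \<open>'a\<close>, this is a relation.\<close>

definition is_beth :: "'i rel \<Rightarrow> 'a rel \<Rightarrow> bool" where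
  "is_beth \<alpha> b \<longleftrightarrow>
     (\<exists>f. (\<forall>i\<in>Field \<alpha>. beth_value (f ` underS \<alpha> i) (f i)) \<and> beth_value (f ` Field \<alpha>) b)"

text \<open>The comparison of \<open>\<kappa>\<close> with the beth number at \<open>\<alpha>\<close>. If that beth number has no
  representative on \<open>'a\<close>, then it exceeds every cardinal on \<open>'a\<close>, in particular \<open>\<kappa>\<close>. Lemma
  \<open>le_beth_iff\<close> below confirms that this is the comparison with the beth number on whatever
  type it lives.\<close>

definition le_beth :: "'a rel \<Rightarrow> 'i rel \<Rightarrow> bool" where
  "le_beth \<kappa> \<alpha> \<longleftrightarrow> (\<forall>b :: 'a rel. is_beth \<alpha> b \<longrightarrow> \<kappa> \<le>o b)"

definition omega1 :: "nat set rel" where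
  "omega1 = cardSuc natLeq"

lemma card_order_copy:
  assumes "Card_order c" and "c \<le>o (b :: 'b rel)"
  obtains d :: "'b rel" where "Card_order d" "d =o c"
proof -
  from internalize_ordLeq[of c b] assms(2) obtain p :: "'b rel" where "c =o p" by blast
  with assms(1) show thesis
    using that[of p] Card_order_ordIso2 ordIso_symmetric by blast
qed

lemma is_card_sup_least:
  assumes "is_card_sup S (b :: 'a rel)" "Card_order (d :: 'b rel)" "\<forall>c\<in>S. c \<le>o d"
  shows "b \<le>o d"
proof (rule ccontr)
  have b: "Card_order b" using assms(1) by (simp add: is_card_sup_def)
  assume "\<not> b \<le>o d"
  then have less: "d <o b"
    using not_ordLeq_iff_ordLess[OF card_order_on_well_order_on[OF assms(2)]
        card_order_on_well_order_on[OF b]] by simp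
  obtain d' :: "'a rel" where d': "Card_order d'" "d' =o d"
    using card_order_copy[OF assms(2) ordLess_imp_ordLeq[OF less]] by blast
  then have "\<forall>c\<in>S. c \<le>o d'"
    using assms(3) ordLeq_ordIso_trans ordIso_symmetric by blast
  then have "b \<le>o d'" using assms(1) d'(1) by (simp add: is_card_sup_def)
  then have "b \<le>o d" using d'(2) ordLeq_ordIso_trans by blast
  with less show False using not_ordLess_ordLeq by blast
qed

lemma beth_value_Card_order: "beth_value S b \<Longrightarrow> Card_order b"
  by (auto simp: beth_value_def is_card_sup_def split: if_splits)

lemma beth_value_exp_le: "beth_value S b \<Longrightarrow> c \<in> S \<Longrightarrow> ctwo ^c c \<le>o b"
  by (auto simp: beth_value_def is_card_sup_def split: if_splits)

lemma exp_two_cong: "c =o d \<Longrightarrow> Card_order c \<Longrightarrow> Card_order d \<Longrightarrow> ctwo ^c c =o ctwo ^c d"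
  by (rule cexp_cong2) (auto simp: Card_order_ctwo)

lemma beth_value_le:
  assumes f: "beth_value (f ` I) (b :: 'a rel)" and g: "beth_value (g ` I) (b' :: 'b rel)"
    and iso: "\<And>i. i \<in> I \<Longrightarrow> f i =o g i"
    and card: "\<And>i. i \<in> I \<Longrightarrow> Card_order (f i)"
  shows "b \<le>o b'"
proof (cases "I = {}")
  case True
  then have "b =o natLeq" "b' =o natLeq" using f g by (auto simp: beth_value_def)
  then show ?thesis using ordIso_symmetric ordIso_transitive ordIso_imp_ordLeq by blast
next
  case False
  have "ctwo ^c f i \<le>o b'" if i: "i \<in> I" for i
  proof -
    have "Card_order (g i)" using card[OF i] iso[OF i] Card_order_ordIso2 by blast
    then have "ctwo ^c f i =o ctwo ^c g i" using exp_two_cong iso card i by blast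
    moreover have "ctwo ^c g i \<le>o b'" using beth_value_exp_le[OF g] i by blast
    ultimately show ?thesis using ordIso_ordLeq_trans by blast
  qed
  moreover have "is_card_sup ((\<lambda>c. ctwo ^c c) ` f ` I) b"
    using f False by (simp add: beth_value_def)
  ultimately show ?thesis
    using is_card_sup_least[OF _ beth_value_Card_order[OF g]] by blast
qed

lemma beth_value_unique:
  assumes "beth_value (f ` I) (b :: 'a rel)" and "beth_value (g ` I) (b' :: 'b rel)"
    and "\<And>i. i \<in> I \<Longrightarrow> f i =o g i" and "\<And>i. i \<in> I \<Longrightarrow> Card_order (f i)"
  shows "b =o b'"
proof -
  have "b' \<le>o b"
    using beth_value_le[OF assms(2,1)] assms(3,4) ordIso_symmetric Card_order_ordIso2 by metis
  moreover have "b \<le>o b'" using beth_value_le[OF assms] .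
  ultimately show ?thesis by (simp add: ordIso_iff_ordLeq)
qed

lemma is_beth_unique:
  assumes wo: "Well_order \<alpha>" and "is_beth \<alpha> (b :: 'a rel)" "is_beth \<alpha> (b' :: 'b rel)"
  shows "b =o b'"
proof -
  from assms obtain f g where
    f: "\<forall>i\<in>Field \<alpha>. beth_value (f ` underS \<alpha> i) (f i)" "beth_value (f ` Field \<alpha>) b" and
    g: "\<forall>i\<in>Field \<alpha>. beth_value (g ` underS \<alpha> i) (g i)" "beth_value (g ` Field \<alpha>) b'"
    unfolding is_beth_def by blast
  have "wo_rel \<alpha>" using wo by (simp add: wo_rel_def)
  have "i \<in> Field \<alpha> \<longrightarrow> f i =o g i" for i
  proof (rule wo_rel.well_order_induct[OF \<open>wo_rel \<alpha>\<close>, of "\<lambda>i. i \<in> Field \<alpha> \<longrightarrow> f i =o g i"],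
      intro impI)
    fix i assume IH: "\<forall>j. j \<noteq> i \<and> (j, i) \<in> \<alpha> \<longrightarrow> j \<in> Field \<alpha> \<longrightarrow> f j =o g j"
      and i: "i \<in> Field \<alpha>"
    show "f i =o g i"
    proof (rule beth_value_unique)
      show "beth_value (f ` underS \<alpha> i) (f i)" "beth_value (g ` underS \<alpha> i) (g i)"
        using f g i by auto
      fix j assume "j \<in> underS \<alpha> i"
      then have j: "j \<noteq> i" "(j, i) \<in> \<alpha>" "j \<in> Field \<alpha>"
        by (auto simp: underS_def Field_def)
      then show "f j =o g j" "Card_order (f j)"
        using IH f beth_value_Card_order by blast+
    qed
  qed
  then show ?thesis
    using beth_value_unique[OF f(2) g(2)] f(1) beth_value_Card_order by blast
qed

lemma beth_value_copy:
  assumes g: "beth_value (g ` I) (b :: 'b rel)" and d: "Card_order (d :: 'a rel)" "d =o b"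
    and iso: "\<And>i. i \<in> I \<Longrightarrow> f i =o g i"
    and card: "\<And>i. i \<in> I \<Longrightarrow> Card_order (f i)" "\<And>i. i \<in> I \<Longrightarrow> Card_order (g i)"
  shows "beth_value (f ` I) d"
proof (cases "I = {}")
  case True
  then show ?thesis using g d ordIso_transitive by (auto simp: beth_value_def)
next
  case False
  have exp: "ctwo ^c f i =o ctwo ^c g i" if "i \<in> I" for i
    using exp_two_cong iso card that by blast
  have sup: "is_card_sup ((\<lambda>c. ctwo ^c c) ` g ` I) b"
    using g False by (simp add: beth_value_def)
  have "ctwo ^c f i \<le>o d" if i: "i \<in> I" for i
  proof -
    have "ctwo ^c g i \<le>o b" using beth_value_exp_le[OF g] i by blast
    then show ?thesis
      using exp[OF i] d(2) ordIso_ordLeq_trans ordLeq_ordIso_trans ordIso_symmetric by blast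
  qed
  moreover have "d \<le>o e" if e: "Card_order e" "\<forall>i\<in>I. ctwo ^c f i \<le>o e" for e :: "'a rel"
  proof -
    have "\<forall>c\<in>(\<lambda>c. ctwo ^c c) ` g ` I. c \<le>o e"
      using e(2) exp ordIso_symmetric ordIso_ordLeq_trans by blast
    then have "b \<le>o e" using is_card_sup_least[OF sup e(1)] by blast
    then show ?thesis using d(2) ordIso_ordLeq_trans by blast
  qed
  ultimately show ?thesis using False d(1) by (simp add: beth_value_def is_card_sup_def)
qed

lemma is_beth_copy:
  assumes "is_beth \<alpha> (b :: 'b rel)" and "b \<le>o (\<kappa> :: 'a rel)"
  obtains d :: "'a rel" where "is_beth \<alpha> d" "d =o b"
proof -
  from assms(1) obtain g where
    g: "\<forall>i\<in>Field \<alpha>. beth_value (g ` underS \<alpha> i) (g i)" "beth_value (g ` Field \<alpha>) b"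
    unfolding is_beth_def by blast
  have card: "Card_order (g i)" if "i \<in> Field \<alpha>" for i
    using g(1) that beth_value_Card_order by blast
  have "\<exists>d :: 'a rel. Card_order d \<and> d =o g i" if i: "i \<in> Field \<alpha>" for i
  proof -
    have "g i \<le>o ctwo ^c g i"
      using card[OF i] ordLess_ctwo_cexp ordLess_imp_ordLeq by blast
    also have "ctwo ^c g i \<le>o b" using beth_value_exp_le[OF g(2)] i by blast
    finally have "g i \<le>o \<kappa>" using assms(2) ordLeq_transitive by blast
    then show ?thesis using card_order_copy[OF card[OF i]] by blast
  qed
  then obtain f :: "_ \<Rightarrow> 'a rel" where
    f: "\<And>i. i \<in> Field \<alpha> \<Longrightarrow> Card_order (f i)" "\<And>i. i \<in> Field \<alpha> \<Longrightarrow> f i =o g i"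
    by metis
  obtain d :: "'a rel" where d: "Card_order d" "d =o b"
    using card_order_copy[OF beth_value_Card_order[OF g(2)] assms(2)] by blast
  have "beth_value (f ` underS \<alpha> i) (f i)" if i: "i \<in> Field \<alpha>" for i
  proof (rule beth_value_copy)
    show "beth_value (g ` underS \<alpha> i) (g i)" using g(1) i by blast
    fix j assume "j \<in> underS \<alpha> i"
    then have "j \<in> Field \<alpha>" by (auto simp: underS_def Field_def)
    then show "f j =o g j" "Card_order (f j)" "Card_order (g j)" using f card by blast+
  qed (use f i in auto)
  moreover have "beth_value (f ` Field \<alpha>) d"
    using beth_value_copy[OF g(2) d] f card by blast
  ultimately have "is_beth \<alpha> d" unfolding is_beth_def by blast
  with d(2) show thesis using that by blast
qed

lemma le_beth_iff:
  assumes "Well_order \<alpha>" and "Card_order (\<kappa> :: 'a rel)" and b: "is_beth \<alpha> (b :: 'b rel)"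
  shows "le_beth \<kappa> \<alpha> \<longleftrightarrow> \<kappa> \<le>o b"
proof
  assume "\<kappa> \<le>o b"
  then show "le_beth \<kappa> \<alpha>"
    unfolding le_beth_def using is_beth_unique[OF assms(1) b] ordLeq_ordIso_trans by blast
next
  assume le: "le_beth \<kappa> \<alpha>"
  show "\<kappa> \<le>o b"
  proof (rule ccontr)
    assume neg: "\<not> \<kappa> \<le>o b"
    from b obtain f :: "_ \<Rightarrow> 'b rel" where "beth_value (f ` Field \<alpha>) b"
      unfolding is_beth_def by auto
    then have "Card_order b" by (rule beth_value_Card_order)
    with neg assms(2) have "b \<le>o \<kappa>"
      using card_order_on_well_order_on ordLeq_total by metis
    then obtain d :: "'a rel" where "is_beth \<alpha> d" "d =o b" using is_beth_copy[OF b] by blast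
    then have "\<kappa> \<le>o b" using le ordLeq_ordIso_trans unfolding le_beth_def by blast
    with neg show False by blast
  qed
qed

end

theory Submission
  imports Defs "HOL-Library.Countable_Set_Type" "HOL-Computational_Algebra.Primes"
begin

text \<open>Groups are attached to labelled trees: the group of a tree is a subgroup of the rational
  vector space on its vertices, in which each vertex is divisible by infinitely many primes that
  depend on its depth and label, and the difference of a vertex of depth \<open>n\<close> and one of its children
  is divisible by all powers of the \<open>n\<close>-th of some further primes. Divisibility is preserved by
  homomorphisms, so an embedding \<open>f\<close> makes the relation ``the coefficient of \<open>f s\<close> at \<open>t\<close> is not
  zero'' a simulation of the first tree by the second one.

  It remains to find trees that do not simulate each other. Single labels give continuum many
  countable ones. If the smaller cardinals of a given stage have been treated, then the trees found
  for them are at least \<open>\<kappa>\<close> many for each \<open>\<kappa>\<close> of the next stage, as every cardinal below \<open>\<kappa>\<close> is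
  less than \<open>2 ^ \<mu>\<close> for some \<open>\<mu>\<close> of an earlier stage. An antichain of subsets of size \<open>\<kappa>\<close> of these
  trees yields the trees of size \<open>\<kappa>\<close>: join the members of a subset at a new root that is labelled by
  the stage. The stages are the ordinals up to \<open>omega1\<close>; the labels must be encoded by sets of
  primes, so at most continuum many stages can be distinguished in this way.\<close>

section \<open>Cardinalities and antichains of subsets\<close>

lemma card_of_less_or_leq: "|A| <o |B| \<or> |B| \<le>o |A|"
  by (rule ordLess_or_ordLeq[OF card_of_Well_order card_of_Well_order])

lemma card_of_finite_less_infinite: "finite A \<Longrightarrow> infinite B \<Longrightarrow> |A| <o |B|"
  using card_of_less_or_leq[of A B] card_of_ordLeq_finite[of B A] by blast

lemma card_of_Pow_mono: "|A| \<le>o |B| \<Longrightarrow> |Pow A| \<le>o |Pow B|"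
  using card_of_ordLeq[of A B] card_of_ordLeq[of "Pow A" "Pow B"] inj_on_image_Pow image_Pow_mono
  by blast

lemma card_of_Pow_cong: "|A| =o |B| \<Longrightarrow> |Pow A| =o |Pow B|"
  by (simp add: ordIso_iff_ordLeq card_of_Pow_mono)

lemma card_of_Pow_cexp: "|Pow (Field r)| =o ctwo ^c r"
  unfolding ctwo_def cexp_def Field_card_of by (rule card_of_Pow_Func)

lemma card_of_lists_infinite:
  assumes "infinite A"
  shows "|lists A| \<le>o |A|"
proof -
  have "|{xs \<in> lists A. length xs = n}| \<le>o |A|" for n
  proof (induction n)
    case 0
    have "{xs \<in> lists A. length xs = 0} = {[]}" by auto
    then show ?case using assms card_of_singl_ordLeq[of A "[]"] by auto
  next
    case (Suc n)
    have "{xs \<in> lists A. length xs = Suc n}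
        \<subseteq> (\<lambda>(a, xs). a # xs) ` (A \<times> {xs \<in> lists A. length xs = n})"
      by (auto simp: length_Suc_conv image_iff)
    then have "|{xs \<in> lists A. length xs = Suc n}| \<le>o |A \<times> {xs \<in> lists A. length xs = n}|"
      by (rule surj_imp_ordLeq)
    also have "|A \<times> {xs \<in> lists A. length xs = n}| \<le>o |A|"
      using Suc assms by (intro card_of_Sigma_ordLeq_infinite) (auto simp: card_of_mono1)
    finally show ?case .
  qed
  moreover have "|UNIV :: nat set| \<le>o |A|"
    using assms infinite_iff_card_of_nat by blast
  ultimately have "|\<Union>n. {xs \<in> lists A. length xs = n}| \<le>o |A|"
    using assms by (intro card_of_UNION_ordLeq_infinite) auto
  moreover have "(\<Union>n. {xs \<in> lists A. length xs = n}) = lists A" by auto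
  ultimately show ?thesis by simp
qed

text \<open>Well-order \<open>X\<close> by its cardinal. An infinite initial segment all of whose
  proper initial segments have smaller cardinality is an initial ordinal; these segments, together
  with \<open>X\<close> itself as the value at \<open>None\<close>, represent each infinite cardinal
  up to \<open>|X|\<close> exactly once.\<close>

lemma infinite_card_representatives:
  fixes X :: "'x set"
  assumes X: "infinite X"
  obtains I and Y :: "'x option \<Rightarrow> 'x set"
  where "I \<subseteq> insert None (Some ` X)" "\<And>i. i \<in> I \<Longrightarrow> Y i \<subseteq> X" "\<And>i. i \<in> I \<Longrightarrow> infinite (Y i)"
    "\<And>i j. i \<in> I \<Longrightarrow> j \<in> I \<Longrightarrow> |Y i| =o |Y j| \<Longrightarrow> i = j"
    "\<And>A. infinite A \<Longrightarrow> A \<subseteq> X \<Longrightarrow> \<exists>i\<in>I. |Y i| =o |A|"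
proof -
  define r where "r = |X|"
  have F: "Field r = X" by (simp add: r_def Field_card_of)
  have wo: "Well_order r" unfolding r_def by (rule card_of_Well_order)
  have co: "Card_order r" unfolding r_def by (rule card_of_Card_order)
  have wr: "wo_rel r" using wo by (simp add: wo_rel_def)
  note TOTALS = wo_rel.TOTALS[OF wr] and TRANS = wo_rel.TRANS[OF wr]
    and ANTISYM = wo_rel.ANTISYM[OF wr] and underS_ofilter = wo_rel.underS_ofilter[OF wr]
  define J where "J = {x \<in> X. infinite (underS r x) \<and>
    (\<forall>y\<in>underS r x. |underS r y| <o |underS r x| )}"
  define Y where "Y i = (case i of None \<Rightarrow> X | Some x \<Rightarrow> underS r x)" for i
  have less: "|underS r x| <o |X|" if "x \<in> X" for x
    using card_of_underS[OF co, of x] that F by (simp add: r_def)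
  show ?thesis
  proof (rule that[of "insert None (Some ` J)" Y])
    show "insert None (Some ` J) \<subseteq> insert None (Some ` X)" by (auto simp: J_def)
    show "Y i \<subseteq> X" for i
      unfolding Y_def F[symmetric] by (auto simp: underS_def Field_def split: option.splits)
    show "i \<in> insert None (Some ` J) \<Longrightarrow> infinite (Y i)" for i
      using X by (auto simp: Y_def J_def)
    fix i j assume ij: "i \<in> insert None (Some ` J)" "j \<in> insert None (Some ` J)" "|Y i| =o |Y j|"
    have JJ: "x = y" if "x \<in> J" "y \<in> J" "|underS r x| =o |underS r y|" for x y
    proof (rule ccontr)
      assume "x \<noteq> y"
      then have "x \<in> underS r y \<or> y \<in> underS r x"
        using TOTALS that(1,2) F unfolding underS_def J_def by auto
      then have "|underS r x| <o |underS r y| \<or> |underS r y| <o |underS r x|"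
        using that unfolding J_def by blast
      then show False using that(3) not_ordLess_ordIso ordIso_symmetric by blast
    qed
    show "i = j"
    proof (cases i; cases j)
      fix x y assume "i = Some x" "j = Some y"
      then show ?thesis using JJ ij by (auto simp: Y_def)
    next
      fix x assume "i = None" "j = Some x"
      then show ?thesis
        using ij less[of x] not_ordLess_ordIso ordIso_symmetric by (auto simp: Y_def J_def)
    next
      fix x assume "i = Some x" "j = None"
      then show ?thesis using ij less[of x] not_ordLess_ordIso by (auto simp: Y_def J_def)
    qed simp
  next
    fix A assume A: "infinite A" "A \<subseteq> X"
    show "\<exists>i\<in>insert None (Some ` J). |Y i| =o |A|"
    proof (cases "|A| =o |X|")
      case True
      then show ?thesis using ordIso_symmetric by (auto simp: Y_def)
    next
      case False
      then have "|A| <o r"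
        using card_of_mono1[OF A(2)] ordLeq_iff_ordLess_or_ordIso unfolding r_def by blast
      then obtain a where a: "a \<in> X" "|A| =o Restr r (underS r a)"
        using ordLess_iff_ordIso_Restr[OF wo card_of_Well_order] F by blast
      have Fld: "Field (Restr r (underS r b)) = underS r b" for b
        using Field_Restr_ofilter[OF wo underS_ofilter] .
      have iso: "|A| =o |underS r a|"
        using card_of_cong[OF a(2)] by (simp only: Field_card_of Fld)
      \<comment> \<open>The order on the segment below \<open>a\<close> is isomorphic to the
        cardinal order \<open>|A|\<close>, so it is itself a cardinal order, and shorter segments of
        it have smaller cardinality.\<close>
      have "|underS r b| <o |underS r a|" if b: "b \<in> underS r a" for b
      proof -
        have wob: "well_order_on (underS r b) (Restr r (underS r b))"
          by (rule well_order_on_Restr[OF wo]) (auto simp: underS_def Field_def)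
        have "|underS r b| \<le>o Restr r (underS r b)" using card_of_least[OF wob] .
        also have "Restr r (underS r b) <o Restr r (underS r a)"
        proof -
          have "underS r b \<subset> underS r a"
            using b underS_incr[OF TRANS ANTISYM, of b a] unfolding underS_def by auto
          then show ?thesis
            using ofilter_subset_ordLess[OF wo underS_ofilter underS_ofilter] by blast
        qed
        also have "Restr r (underS r a) =o |underS r a|"
          using a(2) iso ordIso_symmetric ordIso_transitive by blast
        finally show ?thesis .
      qed
      then have "a \<in> J" using a(1) A(1) iso card_of_ordIso_finite by (auto simp: J_def)
      then show ?thesis using iso ordIso_symmetric by (auto simp: Y_def)
    qed
  qed
qed

text \<open>The members of the antichain are graphs over representatives \<open>Y i\<close> of the cardinals below
  \<open>|X|\<close>; tagging each point with \<open>i\<close> makes graphs of different cardinality incomparable.\<close>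

lemma infinite_antichain:
  fixes X :: "'x set"
  assumes X: "infinite X"
  obtains S where "\<And>P Q. P \<in> S \<Longrightarrow> Q \<in> S \<Longrightarrow> P \<subseteq> Q \<Longrightarrow> P = Q" "\<And>P. P \<in> S \<Longrightarrow> P \<subseteq> X"
    "\<And>A. infinite A \<Longrightarrow> A \<subseteq> X \<Longrightarrow> |{P \<in> S. |P| =o |A| }| =o |Pow A|"
proof -
  obtain I and Y :: "'x option \<Rightarrow> 'x set" where
    I: "I \<subseteq> insert None (Some ` X)" and Y: "\<And>i. i \<in> I \<Longrightarrow> Y i \<subseteq> X" "\<And>i. i \<in> I \<Longrightarrow> infinite (Y i)"
    "\<And>i j. i \<in> I \<Longrightarrow> j \<in> I \<Longrightarrow> |Y i| =o |Y j| \<Longrightarrow> i = j"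
    "\<And>A. infinite A \<Longrightarrow> A \<subseteq> X \<Longrightarrow> \<exists>i\<in>I. |Y i| =o |A|"
    by (rule infinite_card_representatives[OF X]) (rule that)
  define N :: "'x option set" where "N = {None}"
  have "|N \<union> Some ` X| \<le>o |X|"
  proof -
    have "|N \<union> Some ` X| \<le>o |N <+> Some ` X|" by (rule card_of_Un_Plus_ordLeq)
    also have "|N <+> Some ` X| \<le>o |N <+> X|"
      by (rule card_of_Plus_mono2) (rule card_of_image)
    also have "|N <+> X| =o |X|"
      using X card_of_singl_ordLeq[of X None] unfolding N_def by (intro card_of_Plus_infinite2) auto
    finally show ?thesis .
  qed
  moreover have "|I| \<le>o |N \<union> Some ` X|" using I by (intro card_of_mono1) (auto simp: N_def)
  ultimately have "|I| \<le>o |X|" using ordLeq_transitive by blast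
  moreover have "|UNIV :: bool set| \<le>o |X|"
    by (rule ordLess_imp_ordLeq[OF card_of_finite_less_infinite[OF _ X]]) simp
  ultimately have "|X \<times> I \<times> (UNIV :: bool set)| \<le>o |X|"
    using X by (intro card_of_Sigma_ordLeq_infinite ballI) (auto simp: card_of_mono1)
  then obtain h where h: "inj_on h (X \<times> I \<times> (UNIV :: bool set))" "h ` (X \<times> I \<times> UNIV) \<subseteq> X"
    using card_of_ordLeq[of "X \<times> I \<times> (UNIV :: bool set)" X] by blast
  \<comment> \<open>The whole characteristic function of \<open>B\<close> on \<open>Y i\<close> is
    recorded, also where it is false. So the size is that of \<open>Y i\<close> for every
    \<open>B\<close>, and an inclusion between two such graphs forces equality.\<close>
  define enc where "enc i B = (\<lambda>y. h (y, i, y \<in> B)) ` Y i" for i B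
  have enc_sub: "i = j \<and> B = C"
    if "i \<in> I" "j \<in> I" "B \<subseteq> Y i" "C \<subseteq> Y j" "enc i B \<subseteq> enc j C" for i j B C
  proof -
    have *: "i = j \<and> (y \<in> B \<longleftrightarrow> y \<in> C)" if y: "y \<in> Y i" for y
    proof -
      have "h (y, i, y \<in> B) \<in> enc j C" using y \<open>enc i B \<subseteq> enc j C\<close> by (auto simp: enc_def)
      then obtain z where z: "z \<in> Y j" "h (y, i, y \<in> B) = h (z, j, z \<in> C)"
        by (auto simp: enc_def)
      have "y \<in> X" "z \<in> X" using y z Y(1) \<open>i \<in> I\<close> \<open>j \<in> I\<close> by auto
      then have "(y, i, y \<in> B) = (z, j, z \<in> C)"
        using inj_onD[OF h(1) z(2)] \<open>i \<in> I\<close> \<open>j \<in> I\<close> by auto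
      then show ?thesis by auto
    qed
    obtain y where "y \<in> Y i" using Y(2)[OF \<open>i \<in> I\<close>] by (metis ex_in_conv finite.emptyI)
    then have "i = j" using * by blast
    with * that show ?thesis by blast
  qed
  have enc_card: "|enc i B| =o |Y i|" if "i \<in> I" for i B
  proof -
    have "inj_on (\<lambda>y. h (y, i, y \<in> B)) (Y i)"
    proof (rule inj_onI)
      fix y z assume yz: "y \<in> Y i" "z \<in> Y i" "h (y, i, y \<in> B) = h (z, i, z \<in> B)"
      then have "y \<in> X" "z \<in> X" using Y(1)[OF that] by auto
      then show "y = z" using inj_onD[OF h(1) yz(3)] that by auto
    qed
    then show ?thesis
      unfolding enc_def using card_of_ordIsoI[OF inj_on_imp_bij_betw] ordIso_symmetric by blast
  qed
  define S where "S = {enc i B |i B. i \<in> I \<and> B \<subseteq> Y i}"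
  show ?thesis
  proof (rule that[of S])
    show "P \<in> S \<Longrightarrow> Q \<in> S \<Longrightarrow> P \<subseteq> Q \<Longrightarrow> P = Q" for P Q
      using enc_sub unfolding S_def by blast
    show "P \<in> S \<Longrightarrow> P \<subseteq> X" for P
      using h(2) Y(1) unfolding S_def enc_def by blast
    fix A assume A: "infinite A" "A \<subseteq> X"
    then obtain i where i: "i \<in> I" "|Y i| =o |A|" using Y(4) by blast
    have "{P \<in> S. |P| =o |A| } = enc i ` Pow (Y i)"
    proof (intro equalityI subsetI)
      fix P assume "P \<in> {P \<in> S. |P| =o |A| }"
      then obtain j B where j: "P = enc j B" "j \<in> I" "B \<subseteq> Y j" "|P| =o |A|"
        by (auto simp: S_def)
      then have "|Y j| =o |A|" using enc_card ordIso_symmetric ordIso_transitive by blast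
      then have "j = i" using Y(3) i j(2) ordIso_symmetric ordIso_transitive by metis
      then show "P \<in> enc i ` Pow (Y i)" using j by blast
    next
      fix P assume "P \<in> enc i ` Pow (Y i)"
      then show "P \<in> {P \<in> S. |P| =o |A| }"
        using i enc_card[OF i(1)] ordIso_transitive unfolding S_def by blast
    qed
    moreover have "inj_on (enc i) (Pow (Y i))"
      using enc_sub[OF i(1) i(1)] by (intro inj_onI) blast
    ultimately have "|{P \<in> S. |P| =o |A| }| =o |Pow (Y i)|"
      using card_of_ordIsoI[OF inj_on_imp_bij_betw] ordIso_symmetric by metis
    then show "|{P \<in> S. |P| =o |A| }| =o |Pow A|"
      using card_of_Pow_cong[OF i(2)] ordIso_transitive by blast
  qed
qed

section \<open>Rational numbers integral at a prime\<close>

text \<open>This is the localization of the integers at \<open>p\<close>. The denominator 0 is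
  excluded, as everything divides 0.\<close>

definition integral_at :: "nat \<Rightarrow> rat \<Rightarrow> bool" where
  "integral_at p x \<longleftrightarrow> (\<exists>a b. x = of_int a / of_int b \<and> \<not> int p dvd b)"

lemma integral_at_of_int: "prime p \<Longrightarrow> integral_at p (of_int a)"
  unfolding integral_at_def by (rule exI[of _ a], rule exI[of _ 1]) auto

lemma integral_at_0 [simp]: "prime p \<Longrightarrow> integral_at p 0"
  using integral_at_of_int[of p 0] by simp

lemma integral_at_uminus [simp]: "integral_at p (- x) \<longleftrightarrow> integral_at p x"
proof -
  have "integral_at p (- x)" if "integral_at p x" for x
    using that unfolding integral_at_def by (metis minus_divide_left of_int_minus)
  from this[of x] this[of "- x"] show ?thesis by auto
qed

lemma integral_at_add:
  assumes "prime p" "integral_at p x" "integral_at p y"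
  shows "integral_at p (x + y)"
proof -
  obtain a b c d where "x = of_int a / of_int b" "\<not> int p dvd b" "y = of_int c / of_int d"
    "\<not> int p dvd d" using assms(2,3) unfolding integral_at_def by auto
  moreover from this have "b \<noteq> 0" "d \<noteq> 0" by auto
  ultimately have "x + y = of_int (a * d + c * b) / of_int (b * d)" "\<not> int p dvd b * d"
    using assms(1) by (auto simp: add_frac_eq prime_dvd_mult_iff mult.commute)
  then show ?thesis unfolding integral_at_def by blast
qed

lemma integral_at_inverse_power:
  assumes "prime p" "prime q" "p \<noteq> q"
  shows "integral_at p (1 / of_nat q ^ k)"
proof -
  have "\<not> int p dvd int q ^ k"
    using assms prime_dvd_power[of p q k] primes_dvd_imp_eq
    by (metis of_nat_dvd_iff of_nat_power)
  then show ?thesis unfolding integral_at_def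
    by (intro exI[of _ 1] exI[of _ "int q ^ k"]) auto
qed

text \<open>Each \<open>d\<close> is coprime to the denominator of its \<open>y\<close>, so it
  divides the numerator of \<open>x\<close>, and a nonzero integer has finitely many divisors. Prime
  and exponent may vary with \<open>d\<close>, which covers both infinitely many primes and all
  powers of one prime.\<close>

lemma eq_0_if_infinitely_divisible:
  assumes "infinite D" and
    D: "\<And>d. d \<in> D \<Longrightarrow> \<exists>p k y. prime p \<and> d = p ^ k \<and> integral_at p y \<and> x = of_nat d * y"
  shows "x = 0"
proof (rule ccontr)
  assume "x \<noteq> 0"
  obtain m n where mn: "x = of_int m / of_int n" "n \<noteq> 0"
    by (cases x) (auto simp: Fract_of_int_quotient)
  then have "m \<noteq> 0" using \<open>x \<noteq> 0\<close> by auto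
  have "int d dvd m" if d: "d \<in> D" for d
  proof -
    obtain p k y where p: "prime p" "d = p ^ k" "integral_at p y" "x = of_nat d * y"
      using D[OF d] by blast
    obtain a b where ab: "y = of_int a / of_int b" "\<not> int p dvd b"
      using p(3) unfolding integral_at_def by auto
    then have "b \<noteq> 0" by auto
    have "of_int (m * b) = (of_int (int d * a * n) :: rat)"
      using p(4) ab(1) mn \<open>b \<noteq> 0\<close> by (simp add: field_simps)
    then have "m * b = int d * a * n" by (simp only: of_int_eq_iff)
    then have "int d dvd m * b" by (simp add: mult.assoc)
    moreover have "coprime (int p) b" using p(1) ab(2) by (simp add: prime_imp_coprime)
    then have "coprime (int d) b" by (simp add: p(2))
    ultimately show ?thesis by (simp add: coprime_dvd_mult_left_iff)
  qed
  then have "D \<subseteq> nat ` {c. c dvd m}" by (force simp: image_iff intro: exI[of _ "int _"])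
  moreover have "finite {c. c dvd m}" using \<open>m \<noteq> 0\<close> by simp
  ultimately show False using assms(1) finite_subset by blast
qed

section \<open>The group of a labelled tree\<close>

text \<open>\<open>Inr A\<close> marks the vertices of the countable trees \<open>leaf A\<close>.
  \<open>Inl i\<close> marks the root of a graft at stage \<open>i\<close>: \<open>None\<close> is
  the last stage, and the others are elements of \<open>Field omega1\<close>, which are sets of
  naturals.\<close>

type_synonym label = "nat set option + nat set"
type_synonym 'a tree = "'a list \<Rightarrow> label option"

section \<open>Primes that encode depth and label\<close>

text \<open>Depth and label become a single subset of a countable set. The first components are
  tags: 0 carries the depth, 1 and 2 tell the two forms of \<open>Inl\<close>, and 3 carries the
  elements of the set in the label.\<close>

definition code :: "nat \<Rightarrow> label \<Rightarrow> (nat \<times> nat) set" where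
  "code n l = insert (0, n) (case l of
     Inl None \<Rightarrow> {(1, 0)} | Inl (Some A) \<Rightarrow> insert (2, 0) (Pair 3 ` A) | Inr A \<Rightarrow> Pair 3 ` A)"

lemma code_inject: "code n l = code n' l' \<longleftrightarrow> n = n' \<and> l = l'"
proof
  assume eq: "code n l = code n' l'"
  have "(0, m) \<in> code n l \<longleftrightarrow> m = n" for m n l
    by (auto simp: code_def split: sum.splits option.splits)
  then have "n = n'" using eq by blast
  have "(1, 0) \<in> code n l \<longleftrightarrow> l = Inl None" for n l
    by (auto simp: code_def split: sum.splits option.splits)
  then have 1: "l = Inl None \<longleftrightarrow> l' = Inl None" using eq by blast
  have "(2, 0) \<in> code n l \<longleftrightarrow> (\<exists>A. l = Inl (Some A))" for n l
    by (auto simp: code_def split: sum.splits option.splits)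
  then have 2: "(\<exists>A. l = Inl (Some A)) \<longleftrightarrow> (\<exists>A. l' = Inl (Some A))" using eq by blast
  have "a \<in> A \<longleftrightarrow> (3, a) \<in> code n l" if "l = Inl (Some A) \<or> l = Inr A" for n l a A
    using that by (auto simp: code_def split: sum.splits option.splits)
  then have 3: "A = B" if "l = Inl (Some A) \<or> l = Inr A" "l' = Inl (Some B) \<or> l' = Inr B" for A B
    using that eq by blast
  have "l = l'"
  proof (cases l)
    case (Inl u) then show ?thesis using 1 2 3 by (cases u) auto
  next
    case (Inr A)
    then obtain B where "l' = Inr B"
      using 1 2 by (metis Inr_not_Inl not_Some_eq sum.exhaust_sel)
    then show ?thesis using 3 Inr by auto
  qed
  with \<open>n = n'\<close> show "n = n' \<and> l = l'" by blast
qed simp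

definition nth_prime :: "nat \<Rightarrow> nat" where
  "nth_prime = enumerate {p. prime p}"

lemma prime_nth_prime: "prime (nth_prime n)"
  using enumerate_in_set[OF primes_infinite] by (simp add: nth_prime_def)

lemma nth_prime_inject [simp]: "nth_prime m = nth_prime n \<longleftrightarrow> m = n"
  using strict_mono_enumerate[OF primes_infinite] strict_mono_eq
  unfolding nth_prime_def by blast

definition edge_prime :: "nat \<Rightarrow> nat" where
  "edge_prime n = nth_prime (2 * n + 1)"

text \<open>Even indices are used for vertices and odd ones for edges, so the two kinds never meet.
  Each pair of a code point \<open>c\<close> and a truth value \<open>b\<close> owns infinitely many
  primes, numbered by \<open>k\<close>.\<close>

definition node_prime :: "nat \<times> nat \<Rightarrow> bool \<Rightarrow> nat \<Rightarrow> nat" where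
  "node_prime c b k = nth_prime (2 * to_nat (c, b, k))"

lemma prime_edge_prime [simp]: "prime (edge_prime n)"
  and prime_node_prime [simp]: "prime (node_prime c b k)"
  and edge_prime_inject [simp]: "edge_prime m = edge_prime n \<longleftrightarrow> m = n"
  and node_prime_inject [simp]: "node_prime c b k = node_prime c' b' k' \<longleftrightarrow> c = c' \<and> b = b' \<and> k = k'"
  and node_prime_neq_edge_prime [simp]: "node_prime c b k \<noteq> edge_prime n"
      "edge_prime n \<noteq> node_prime c b k"
proof -
  show "node_prime c b k \<noteq> edge_prime n" for c b k n
    unfolding edge_prime_def node_prime_def nth_prime_inject by presburger
  then show "edge_prime n \<noteq> node_prime c b k" for c b k n by metis
qed (auto simp: edge_prime_def node_prime_def prime_nth_prime)

text \<open>Absence of a point from the code is recorded by primes just as its presence is. Hence a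
  point in only one of two codes yields infinitely many primes that are allowed at the first vertex
  and forbidden at the second, and also the other way round.\<close>

definition label_primes :: "nat \<Rightarrow> label \<Rightarrow> nat set" where
  "label_primes n l = {node_prime c b k |c b k. (c \<in> code n l) = b}"

definition other_primes :: "nat \<Rightarrow> label \<Rightarrow> nat set" where
  "other_primes n l = {node_prime c b k |c b k. (c \<in> code n l) \<noteq> b}"

lemma label_primes_disjoint: "p \<in> label_primes n l \<Longrightarrow> p \<notin> other_primes n l"
  by (auto simp: label_primes_def other_primes_def)

lemma infinite_label_primes_diff:
  assumes "(n, l) \<noteq> (n', l')"
  shows "infinite (label_primes n l \<inter> other_primes n' l')"
proof -
  have "code n l \<noteq> code n' l'" using assms code_inject by blast
  then obtain c where c: "(c \<in> code n l) \<noteq> (c \<in> code n' l')" by blast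
  have "range (node_prime c (c \<in> code n l)) \<subseteq> label_primes n l \<inter> other_primes n' l'"
    using c unfolding label_primes_def other_primes_def by blast
  moreover have "infinite (range (node_prime c (c \<in> code n l)))"
    by (rule range_inj_infinite) (simp add: inj_on_def)
  ultimately show ?thesis using finite_subset by blast
qed

section \<open>Rational vectors on the vertices of a tree\<close>

definition star :: "('a list \<Rightarrow> rat) \<Rightarrow> 'a list \<Rightarrow> rat" where
  "star x s = x s + (\<Sum>b | x (s @ [b]) \<noteq> 0. x (s @ [b]))"

text \<open>A vertex \<open>s\<close> may be divided by the primes of its depth and label, and the difference of a
  vertex of depth \<open>n\<close> and one of its children by all powers of \<open>edge_prime n\<close>. As
  \<open>star\<close> vanishes at depth \<open>n\<close> on these differences, it can be required to be integral at
  \<open>edge_prime n\<close>; so it vanishes on every element divisible by all powers of \<open>edge_prime n\<close>.\<close>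

definition tree_vectors :: "'a tree \<Rightarrow> ('a list \<Rightarrow> rat) set" where
  "tree_vectors t = {x. finite {s. x s \<noteq> 0} \<and> (\<forall>s. x s \<noteq> 0 \<longrightarrow> t s \<noteq> None) \<and>
     (\<forall>s l. t s = Some l \<longrightarrow> (\<forall>p\<in>other_primes (length s) l. integral_at p (x s)) \<and>
        integral_at (edge_prime (length s)) (star x s))}"

definition tree_group :: "'a tree \<Rightarrow> ('a list \<Rightarrow> rat) monoid" where
  "tree_group t = \<lparr>carrier = tree_vectors t, monoid.mult = (\<lambda>x y s. x s + y s), one = (\<lambda>_. 0)\<rparr>"

lemma finite_children:
  assumes "finite {s. x s \<noteq> (0::rat)}"
  shows "finite {b. x (s @ [b]) \<noteq> 0}"
proof -
  have "finite ((\<lambda>b. s @ [b]) -` {s. x s \<noteq> 0})"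
    using assms by (rule finite_vimageI) (simp add: inj_on_def)
  then show ?thesis by (simp add: vimage_def)
qed

text \<open>The index set in \<open>star\<close> depends on the vector; a common finite superset
  lets sums for different vectors be compared.\<close>

lemma star_superset:
  assumes "finite B" "{b. x (s @ [b]) \<noteq> 0} \<subseteq> B"
  shows "star x s = x s + (\<Sum>b\<in>B. x (s @ [b]))"
proof -
  have "(\<Sum>b | x (s @ [b]) \<noteq> 0. x (s @ [b])) = (\<Sum>b\<in>B. x (s @ [b]))"
    using assms by (rule sum.mono_neutral_left) auto
  then show ?thesis by (simp only: star_def)
qed

lemma star_add:
  assumes "finite {s. x s \<noteq> 0}" "finite {s. y s \<noteq> 0}"
  shows "star (\<lambda>s. x s + y s) s = star x s + star y s"
proof -
  let ?B = "{b. x (s @ [b]) \<noteq> 0} \<union> {b. y (s @ [b]) \<noteq> 0}"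
  have "finite ?B" using finite_children assms by blast
  moreover have "{b. x (s @ [b]) + y (s @ [b]) \<noteq> 0} \<subseteq> ?B" by auto
  ultimately show ?thesis
    using star_superset[of ?B x s] star_superset[of ?B y s] star_superset[of ?B "\<lambda>s. x s + y s" s]
    by (simp add: sum.distrib)
qed

lemma star_scale: "star (\<lambda>s. c * x s) s = c * star x s"
  \<comment> \<open>Scaling by a nonzero \<open>c\<close> keeps the index set of the sum, while
    scaling by 0 empties it.\<close>
  by (cases "c = 0") (simp_all add: star_def sum_distrib_left distrib_left)

lemma star_uminus: "star (\<lambda>s. - x s) s = - star x s"
  using star_scale[of "-1" x s] by simp

lemma tree_vectors_add:
  assumes "x \<in> tree_vectors t" "y \<in> tree_vectors t"
  shows "(\<lambda>s. x s + y s) \<in> tree_vectors t"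
proof -
  have "finite {s. x s + y s \<noteq> 0}"
    by (rule finite_subset[of _ "{s. x s \<noteq> 0} \<union> {s. y s \<noteq> 0}"])
      (use assms in \<open>auto simp: tree_vectors_def\<close>)
  moreover have "integral_at p (x s + y s)"
    if "t s = Some l" "p \<in> other_primes (length s) l" for s l p
  proof -
    have "prime p" using that(2) by (auto simp: other_primes_def)
    then show ?thesis
      using integral_at_add assms that unfolding tree_vectors_def by blast
  qed
  moreover have "integral_at (edge_prime (length s)) (star (\<lambda>s. x s + y s) s)"
    if "t s = Some l" for s l
    using assms that star_add[of x y s] integral_at_add[OF prime_edge_prime]
    unfolding tree_vectors_def by auto
  moreover have "t s \<noteq> None" if "x s + y s \<noteq> 0" for s
    using assms that unfolding tree_vectors_def by (cases "x s = 0") auto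
  ultimately show ?thesis unfolding tree_vectors_def by blast
qed

lemma tree_vectors_uminus:
  "x \<in> tree_vectors t \<Longrightarrow> (\<lambda>s. - x s) \<in> tree_vectors t"
  by (simp add: tree_vectors_def star_uminus)

lemma tree_vectors_zero: "(\<lambda>_. 0) \<in> tree_vectors t"
  by (auto simp: tree_vectors_def star_def other_primes_def)

lemma group_tree_group: "group (tree_group t)"
proof (rule groupI)
  show "\<exists>y\<in>carrier (tree_group t). y \<otimes>\<^bsub>tree_group t\<^esub> x = \<one>\<^bsub>tree_group t\<^esub>"
    if "x \<in> carrier (tree_group t)" for x
    using that tree_vectors_uminus by (force simp: tree_group_def)
qed (auto simp: tree_group_def tree_vectors_add tree_vectors_zero add.assoc)

lemma tree_group_pow: "x [^]\<^bsub>tree_group t\<^esub> (n::nat) = (\<lambda>s. of_nat n * x s)"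
proof (induction n)
  case 0
  show ?case by (simp add: nat_pow_def tree_group_def)
next
  case (Suc n)
  then show ?case by (simp add: nat_pow_def tree_group_def distrib_right add.commute)
qed

lemma torsion_free_tree_group: "torsion_free (tree_group t)"
  unfolding torsion_free_def tree_group_pow by (auto simp: tree_group_def fun_eq_iff)

definition vertex :: "'a list \<Rightarrow> 'a list \<Rightarrow> rat" where
  "vertex s = (\<lambda>u. if u = s then 1 else 0)"

text \<open>A prime of the depth and label of \<open>s\<close> is neither among the other primes of
  \<open>s\<close> nor an edge prime. So \<open>1 / p\<close> is integral at every prime that
  matters at \<open>s\<close>, and all coefficients elsewhere vanish.\<close>

lemma vertex_div_mem:
  assumes "t s = Some l" "p \<in> label_primes (length s) l"
  shows "(\<lambda>u. vertex s u / of_nat p) \<in> tree_vectors t"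
proof -
  obtain c b k where p: "p = node_prime c b k" using assms(2) by (auto simp: label_primes_def)
  then have "prime p" by simp
  have "integral_at q (1 / of_nat p)" if "prime q" "q \<noteq> p" for q
    using integral_at_inverse_power[of q p 1] that \<open>prime p\<close> by simp
  then have int: "integral_at (edge_prime n) (1 / of_nat p)" for n by (simp add: p)
  have "{u. vertex s u / of_nat p \<noteq> 0} \<subseteq> {s}" by (auto simp: vertex_def)
  then have "finite {u. vertex s u / of_nat p \<noteq> 0}" using finite_subset by blast
  moreover have "star (\<lambda>u. vertex s u / of_nat p) u \<in> {0, 1 / of_nat p}" for u
  proof -
    have "star (\<lambda>u. vertex s u / of_nat p) u = vertex s u / of_nat p +
        (\<Sum>b\<in>{last s}. vertex s (u @ [b]) / of_nat p)"
      by (rule star_superset) (auto simp: vertex_def)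
    then show ?thesis by (auto simp: vertex_def)
  qed
  then have "integral_at (edge_prime n) (star (\<lambda>u. vertex s u / of_nat p) u)" for u n
    using int by (metis empty_iff insertE integral_at_0 prime_edge_prime)
  moreover have "integral_at q (vertex s u / of_nat p)"
    if "t u = Some l'" "q \<in> other_primes (length u) l'" for u l' q
  proof -
    have q: "prime q" using that(2) by (auto simp: other_primes_def)
    show ?thesis
    proof (cases "u = s")
      case True
      then have "q \<noteq> p" using that assms label_primes_disjoint by auto
      then show ?thesis using True q \<open>prime q \<Longrightarrow> q \<noteq> p \<Longrightarrow> integral_at q (1 / of_nat p)\<close>
        by (simp add: vertex_def)
    qed (use q in \<open>simp add: vertex_def\<close>)
  qed
  moreover have "t u \<noteq> None" if "vertex s u / of_nat p \<noteq> 0" for u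
    using that assms(1) by (auto simp: vertex_def split: if_splits)
  ultimately show ?thesis unfolding tree_vectors_def by blast
qed

lemma vertex_mem:
  assumes "t s \<noteq> None"
  shows "vertex s \<in> tree_vectors t"
proof -
  have "integral_at p 1" if "prime p" for p using integral_at_of_int[OF that, of 1] by simp
  moreover have "star (vertex s) u \<in> {0, 1}" for u
  proof -
    have "star (vertex s) u = vertex s u + (\<Sum>b\<in>{last s}. vertex s (u @ [b]))"
      by (rule star_superset) (auto simp: vertex_def)
    then show ?thesis by (auto simp: vertex_def)
  qed
  ultimately have "integral_at (edge_prime n) (star (vertex s) u)" for u n
    by (metis empty_iff insertE integral_at_0 prime_edge_prime)
  moreover have "integral_at q (vertex s u)" if "q \<in> other_primes (length u) l'" for u l' q
    using that \<open>\<And>p. prime p \<Longrightarrow> integral_at p 1\<close>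
    by (auto simp: other_primes_def vertex_def)
  moreover have "finite {u. vertex s u \<noteq> 0}"
    by (rule finite_subset[of _ "{s}"]) (auto simp: vertex_def)
  ultimately show ?thesis
    using assms by (auto simp: tree_vectors_def vertex_def split: if_splits)
qed

text \<open>At \<open>s\<close> the two coefficients cancel in \<open>star\<close>. At the parent of
  \<open>s\<close> and at the child the depth, hence the edge prime, is a different one, and
  elsewhere \<open>star\<close> is zero. The coefficients themselves need only be integral at node
  primes, which differ from all edge primes.\<close>

lemma edge_div_mem:
  assumes "t s \<noteq> None" "t (s @ [a]) \<noteq> None"
  shows "(\<lambda>u. (vertex s u - vertex (s @ [a]) u) / of_nat (edge_prime (length s)) ^ k)
    \<in> tree_vectors t"
proof -
  define c :: rat where "c = 1 / of_nat (edge_prime (length s)) ^ k"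
  define x where "x u = (vertex s u - vertex (s @ [a]) u) * c" for u
  have x: "x u = (if u = s then c else if u = s @ [a] then - c else 0)" for u
    by (auto simp: x_def vertex_def)
  have c: "integral_at p c" if "prime p" "p \<noteq> edge_prime (length s)" for p
    unfolding c_def using that by (intro integral_at_inverse_power) auto
  have "{u. x u \<noteq> 0} \<subseteq> {s, s @ [a]}" by (auto simp: x split: if_splits)
  then have "finite {u. x u \<noteq> 0}" using finite_subset by blast
  moreover have "integral_at (edge_prime (length u)) (star x u)" for u
  proof -
    consider "u = s" | "u = s @ [a]" | b where "s = u @ [b]"
      | "u \<noteq> s" "u \<noteq> s @ [a]" "\<And>b. s \<noteq> u @ [b]" by blast
    then show ?thesis
    proof cases
      case 1
      have "star x u = x u + (\<Sum>b\<in>{a}. x (u @ [b]))"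
        by (rule star_superset) (auto simp: x 1 split: if_splits)
      then show ?thesis by (simp add: x 1)
    next
      case 2
      have "star x u = x u + (\<Sum>b\<in>{}. x (u @ [b]))"
        by (rule star_superset) (auto simp: x 2 split: if_splits)
      then show ?thesis using c[of "edge_prime (length u)"] by (simp add: x 2)
    next
      case (3 b)
      have "star x u = x u + (\<Sum>b\<in>{b}. x (u @ [b]))"
        by (rule star_superset) (auto simp: x 3 split: if_splits)
      then show ?thesis using c[of "edge_prime (length u)"] by (simp add: x 3)
    next
      case 4
      have "star x u = x u + (\<Sum>b\<in>{}. x (u @ [b]))"
        by (rule star_superset) (use 4 in \<open>auto simp: x split: if_splits\<close>)
      then show ?thesis using 4 by (simp add: x)
    qed
  qed
  moreover have "integral_at q (x u)" if "q \<in> other_primes (length u) l'" for u l' q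
    using that c by (auto simp: other_primes_def x)
  moreover have "t u \<noteq> None" if "x u \<noteq> 0" for u
    using that assms by (auto simp: x split: if_splits)
  ultimately have "x \<in> tree_vectors t" unfolding tree_vectors_def by blast
  then show ?thesis by (simp add: x_def[abs_def] c_def)
qed

section \<open>From embeddings to simulations\<close>

text \<open>Simulation as for transition systems: steps to children in \<open>H\<close> are answered
  in \<open>K\<close> with equal labels. \<open>R\<close> is a relation and not a map because a
  homomorphism sends a vertex to a combination of several vertices.\<close>

definition simulates :: "'a tree \<Rightarrow> 'a tree \<Rightarrow> bool" where
  "simulates K H \<longleftrightarrow> (\<exists>R. R [] [] \<and> (\<forall>s t. R s t \<longrightarrow> H s \<noteq> None \<and> K t = H s) \<and>
     (\<forall>s t a. R s t \<longrightarrow> H (s @ [a]) \<noteq> None \<longrightarrow> (\<exists>b. R (s @ [a]) (t @ [b]))))"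

lemma simulates_if_mon:
  assumes f: "f \<in> mon (tree_group H) (tree_group K)" and root: "H [] \<noteq> None"
  shows "simulates K H"
proof -
  have mem: "f x \<in> tree_vectors K" if "x \<in> tree_vectors H" for x
    using f that by (auto simp: mon_def hom_def tree_group_def)
  have add: "f (\<lambda>s. x s + y s) = (\<lambda>s. f x s + f y s)"
    if "x \<in> tree_vectors H" "y \<in> tree_vectors H" for x y
    using f that by (auto simp: mon_def hom_def tree_group_def)
  have zero: "f (\<lambda>_. 0) = (\<lambda>_. 0)"
    using add[OF tree_vectors_zero tree_vectors_zero] by (simp add: fun_eq_iff)
  have minus: "f (\<lambda>s. - x s) = (\<lambda>s. - f x s)" if "x \<in> tree_vectors H" for x
    using add[OF that tree_vectors_uminus[OF that]] zero
    by (simp add: fun_eq_iff eq_neg_iff_add_eq_0 add.commute)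
  have scale: "(\<lambda>s. of_nat n * x s) \<in> tree_vectors H \<and>
      f (\<lambda>s. of_nat n * x s) = (\<lambda>s. of_nat n * f x s)" if "x \<in> tree_vectors H" for x n
  proof (induction n)
    case 0
    then show ?case using zero tree_vectors_zero by simp
  next
    case (Suc n)
    then show ?case
      using add[OF that, of "\<lambda>s. of_nat n * x s"] tree_vectors_add[OF that, of "\<lambda>s. of_nat n * x s"]
      by (simp add: distrib_right)
  qed
  \<comment> \<open>The image of \<open>s\<close> is divisible by all primes of its depth and label.
    If \<open>t\<close> differed in either, its coefficient would have to be integral at the
    quotients by infinitely many of these primes, hence be zero.\<close>
  have same: "K t = H s \<and> length t = length s" if s: "H s \<noteq> None" "f (vertex s) t \<noteq> 0" for s t
  proof (rule ccontr)
    assume neg: "\<not> (K t = H s \<and> length t = length s)"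
    have "K t \<noteq> None" using mem[OF vertex_mem[of H s]] s by (auto simp: tree_vectors_def)
    then obtain l l' where l: "H s = Some l" "K t = Some l'" using s(1) by blast
    have "f (vertex s) t = 0"
    proof (rule eq_0_if_infinitely_divisible)
      show "infinite (label_primes (length s) l \<inter> other_primes (length t) l')"
        using neg l by (intro infinite_label_primes_diff) auto
      fix p assume p: "p \<in> label_primes (length s) l \<inter> other_primes (length t) l'"
      let ?y = "\<lambda>u. vertex s u / of_nat p"
      have y: "?y \<in> tree_vectors H" using vertex_div_mem l(1) p by blast
      have "prime p" using p by (auto simp: label_primes_def)
      then have "p \<noteq> 0" by auto
      then have "f (vertex s) t = of_nat p * f ?y t"
        using scale[OF y, of p] by (auto simp: fun_eq_iff)
      moreover have "integral_at p (f ?y t)"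
        using mem[OF y] l(2) p by (auto simp: tree_vectors_def)
      ultimately show "\<exists>q k y. prime q \<and> p = q ^ k \<and> integral_at q y \<and> f (vertex s) t = of_nat p * y"
        using \<open>prime p\<close> by (metis power_one_right)
    qed
    with s(2) show False by blast
  qed
  \<comment> \<open>The image \<open>?z\<close> of the edge is divisible by all powers of the edge
    prime, so its \<open>star\<close> at \<open>t\<close> is zero. By \<open>same\<close>, the image
    of the child has no coefficient at \<open>t\<close>, and that of \<open>s\<close> has none at
    the children of \<open>t\<close>. Without a suitable \<open>b\<close>, only the nonzero
    coefficient of \<open>f (vertex s)\<close> at \<open>t\<close> would remain in this sum.\<close>
  have step: "\<exists>b. f (vertex (s @ [a])) (t @ [b]) \<noteq> 0"
    if s: "H s \<noteq> None" "f (vertex s) t \<noteq> 0" "H (s @ [a]) \<noteq> None" for s t a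
  proof (rule ccontr)
    assume neg: "\<not> ?thesis"
    let ?q = "edge_prime (length s)"
    let ?z = "\<lambda>u. f (vertex s) u + - f (vertex (s @ [a])) u"
    have len: "length t = length s" "K t \<noteq> None" using same[OF s(1,2)] s(1) by auto
    have v: "vertex s \<in> tree_vectors H" "vertex (s @ [a]) \<in> tree_vectors H"
      using vertex_mem s by auto
    have "star ?z t = 0"
    proof (rule eq_0_if_infinitely_divisible)
      show "infinite (range ((^) ?q))"
        using prime_gt_1_nat[OF prime_edge_prime, of "length s"]
        by (intro range_inj_infinite) (auto simp: inj_on_def)
      fix d assume "d \<in> range ((^) ?q)"
      then obtain k where d: "d = ?q ^ k" by blast
      let ?y = "\<lambda>u. (vertex s u - vertex (s @ [a]) u) / of_nat ?q ^ k"
      have y: "?y \<in> tree_vectors H" by (rule edge_div_mem[OF s(1,3)])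
      have "d \<noteq> 0" using prime_gt_0_nat[OF prime_edge_prime, of "length s"] d by auto
      then have "(\<lambda>u. of_nat d * ?y u) = (\<lambda>u. vertex s u + - vertex (s @ [a]) u)"
        by (auto simp: d fun_eq_iff)
      then have "?z = (\<lambda>u. of_nat d * f ?y u)"
        using scale[OF y, of d] add[OF v(1) tree_vectors_uminus[OF v(2)]] minus[OF v(2)] by simp
      then have "star ?z t = of_nat d * star (f ?y) t" by (simp only: star_scale)
      moreover obtain l where "K t = Some l" using len(2) by blast
      then have "integral_at (edge_prime (length t)) (star (f ?y) t)"
        using mem[OF y] unfolding tree_vectors_def by blast
      then have "integral_at ?q (star (f ?y) t)" by (simp only: len(1))
      ultimately show "\<exists>p k y. prime p \<and> d = p ^ k \<and> integral_at p y \<and> star ?z t = of_nat d * y"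
        using d prime_edge_prime by blast
    qed
    moreover have "?z t \<noteq> 0"
      using same[OF s(3), of t] s(2) len by auto
    moreover have "?z (t @ [b]) = 0" for b
      using neg same[OF s(1), of "t @ [b]"] len by auto
    then have "star ?z t = ?z t" by (simp add: star_def)
    ultimately show False by simp
  qed
  \<comment> \<open>Injectivity starts the simulation: the root has a nonzero image. From there
    \<open>step\<close> leads on to the children.\<close>
  have "\<exists>t. f (vertex []) t \<noteq> 0"
  proof (rule ccontr)
    assume "\<not> ?thesis"
    then have "f (vertex []) = f (\<lambda>_. 0)" using zero by auto
    moreover have "inj_on f (tree_vectors H)" using f by (auto simp: mon_def tree_group_def)
    ultimately have "vertex [] = (\<lambda>_::'a list. 0)"
      using vertex_mem[of H "[]", OF root] tree_vectors_zero by (auto dest: inj_onD)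
    from fun_cong[OF this, of "[]"] show False by (simp add: vertex_def)
  qed
  then obtain t where "f (vertex []) t \<noteq> 0" by blast
  moreover from same[OF root this] have "t = []" by simp
  ultimately have "f (vertex []) [] \<noteq> 0" by simp
  define R where "R s t \<longleftrightarrow> H s \<noteq> None \<and> f (vertex s) t \<noteq> 0" for s t
  show ?thesis
    unfolding simulates_def
  proof (intro exI[of _ R] conjI allI impI)
    show "R [] []" using root \<open>f (vertex []) [] \<noteq> 0\<close> by (simp add: R_def)
    show "H s \<noteq> None" "K t = H s" if "R s t" for s t
      using that same[of s t] by (simp_all add: R_def)
    show "\<exists>b. R (s @ [a]) (t @ [b])" if "R s t" "H (s @ [a]) \<noteq> None" for s t a
      using that step[of s t a] by (simp add: R_def)
  qed
qed

text \<open>A vector is determined by the finite graph of its nonzero coefficients, which is the set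
  of entries of a list over \<open>dom t\<close> times the rationals. Conversely, every vertex is a
  vector.\<close>

lemma card_of_tree_vectors:
  assumes inf: "infinite (dom t)"
  shows "|tree_vectors t| =o |dom t|"
proof -
  define g where "g = (\<lambda>x :: 'a list \<Rightarrow> rat. {(s, x s) |s. x s \<noteq> 0})"
  have pairs: "|dom t \<times> (UNIV :: rat set)| \<le>o |dom t|"
  proof (intro card_of_Sigma_ordLeq_infinite inf ballI)
    have "|UNIV :: rat set| \<le>o |UNIV :: nat set|"
      using countable_card_of_nat[of "UNIV :: rat set"] by simp
    then show "|UNIV :: rat set| \<le>o |dom t|"
      using inf infinite_iff_card_of_nat ordLeq_transitive by blast
  qed (auto simp: card_of_mono1)
  have "inj_on g (tree_vectors t)"
  proof (rule inj_onI)
    fix x y assume eq: "g x = g y"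
    have "(s, r) \<in> g x \<longleftrightarrow> x s = r \<and> r \<noteq> 0" for x s r by (auto simp: g_def)
    then have "x s = y s" for s using eq by metis
    then show "x = y" by blast
  qed
  moreover have "g x \<in> set ` lists (dom t \<times> UNIV)" if x: "x \<in> tree_vectors t" for x
  proof -
    have "g x = (\<lambda>s. (s, x s)) ` {s. x s \<noteq> 0}" by (auto simp: g_def)
    then have "finite (g x)" using x by (simp add: tree_vectors_def)
    then obtain xs where "set xs = g x" using finite_list by blast
    moreover have "g x \<subseteq> dom t \<times> UNIV" using x by (auto simp: g_def tree_vectors_def dom_def)
    ultimately show ?thesis by (metis imageI lists_eq_set mem_Collect_eq)
  qed
  ultimately have "|tree_vectors t| \<le>o |set ` lists (dom t \<times> (UNIV :: rat set))|"
    by (rule card_of_ordLeqI)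
  also have "|set ` lists (dom t \<times> (UNIV :: rat set))| \<le>o |lists (dom t \<times> (UNIV :: rat set))|"
    by (rule card_of_image)
  also have "|lists (dom t \<times> (UNIV :: rat set))| \<le>o |dom t \<times> (UNIV :: rat set)|"
    using inf by (intro card_of_lists_infinite) (auto dest: finite_cartesian_productD1)
  also note pairs
  finally have "|tree_vectors t| \<le>o |dom t|" .
  moreover have "|dom t| \<le>o |tree_vectors t|"
  proof (rule card_of_ordLeqI)
    show "inj_on vertex (dom t)"
      by (rule inj_onI) (metis vertex_def zero_neq_one)
    show "vertex s \<in> tree_vectors t" if "s \<in> dom t" for s
      using vertex_mem[of t s] that by auto
  qed
  ultimately show ?thesis unfolding ordIso_iff_ordLeq by (rule conjI)
qed

section \<open>Levels of cardinals\<close>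

text \<open>\<open>Some i\<close> with \<open>i \<in> Field omega1\<close> stands for a countable ordinal, \<open>None\<close> for \<open>omega1\<close>.\<close>

definition level_less :: "(nat set option \<times> nat set option) set" where
  "level_less = {(Some i, Some j) |i j. i \<in> underS omega1 j} \<union> {(Some i, None) |i. i \<in> Field omega1}"

lemma level_less_simps [simp]:
  "(Some i, Some j) \<in> level_less \<longleftrightarrow> i \<in> underS omega1 j"
  "(Some i, None) \<in> level_less \<longleftrightarrow> i \<in> Field omega1"
  "(None, k) \<notin> level_less"
  by (auto simp: level_less_def)

lemma level_lessE:
  assumes "(j, i) \<in> level_less"
  obtains a where "j = Some a"
  using assms by (auto simp: level_less_def)

definition levels :: "nat set option set" where
  "levels = insert None (Some ` Field omega1)"

lemma Well_order_omega1: "Well_order omega1"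
  unfolding omega1_def using cardSuc_Card_order[OF natLeq_Card_order]
  by (rule card_order_on_well_order_on)

lemma wf_level_less: "wf level_less"
  unfolding wf_eq_minimal
proof (intro allI impI)
  fix Q :: "nat set option set" and x assume x: "x \<in> Q"
  show "\<exists>z\<in>Q. \<forall>y. (y, z) \<in> level_less \<longrightarrow> y \<notin> Q"
  proof (cases "\<exists>i. Some i \<in> Q")
    case True
    then obtain i0 where i0: "i0 \<in> {i. Some i \<in> Q}" by blast
    have "wf (omega1 - Id)" using Well_order_omega1 by (simp add: well_order_on_def)
    from wfE_min[OF this i0] obtain i
      where i: "i \<in> {i. Some i \<in> Q}" "\<And>j. (j, i) \<in> omega1 - Id \<Longrightarrow> j \<notin> {i. Some i \<in> Q}"
      by metis
    have "y \<notin> Q" if "(y, Some i) \<in> level_less" for y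
      using that i(2) by (auto simp: level_less_def underS_def)
    then show ?thesis using i(1) by blast
  next
    case False
    then show ?thesis using x by (intro bexI[of _ x]) (auto simp: level_less_def)
  qed
qed

lemma level_less_trans:
  assumes "(i, j) \<in> level_less" "(j, k) \<in> level_less"
  shows "(i, k) \<in> level_less"
proof -
  have wo: "trans omega1" "antisym omega1" using Well_order_omega1 by (auto simp: order_on_defs)
  have S: "a \<in> underS omega1 c" if "a \<in> underS omega1 b" "b \<in> underS omega1 c" for a b c
    using that wo unfolding underS_def by (auto dest: transD antisymD)
  have F: "a \<in> Field omega1" if "a \<in> underS omega1 b" for a b
    using that by (auto simp: underS_def Field_def)
  obtain a b where "i = Some a" "j = Some b"
    using assms level_less_simps(3) by (metis option.exhaust)
  then show ?thesis using assms S F by (cases k) auto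
qed

lemma level_less_total:
  assumes "i \<in> levels" "j \<in> levels"
  shows "(i, j) \<in> level_less \<or> i = j \<or> (j, i) \<in> level_less"
proof -
  have "total_on (Field omega1) omega1" using Well_order_omega1 by (simp add: order_on_defs)
  then have "a \<in> underS omega1 b \<or> a = b \<or> b \<in> underS omega1 a"
    if "a \<in> Field omega1" "b \<in> Field omega1" for a b
    using that unfolding underS_def total_on_def by blast
  then show ?thesis using assms by (cases i; cases j) (auto simp: levels_def)
qed

lemma level_less_levels: "(i, j) \<in> level_less \<Longrightarrow> i \<in> levels \<and> j \<in> levels \<and> (i, None) \<in> level_less"
  by (auto simp: level_less_def levels_def underS_def Field_def)

text \<open>\<open>le_level i A\<close> says that \<open>|A|\<close> is at most the beth number at \<open>i\<close>, without assuming that this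
  beth number is represented on the type of \<open>A\<close>.\<close>

inductive le_level :: "nat set option \<Rightarrow> 'a set \<Rightarrow> bool" where
  countable: "countable A \<Longrightarrow> le_level i A"
| step: "(\<And>B :: 'a set. |B| <o |A| \<Longrightarrow>
      \<exists>j C. (j, i) \<in> level_less \<and> le_level j C \<and> |B| <o |Pow C| ) \<Longrightarrow> le_level i A"

text \<open>That each smaller cardinal lies below some \<open>2 ^ |C|\<close> expresses that
  \<open>|A|\<close> is at most the supremum of these powers. Unlike the supremum, this form stays
  within the type of \<open>A\<close>.\<close>

lemma le_level_stepD:
  fixes A B :: "'a set"
  assumes "le_level i A" "uncountable A" "|B| <o |A|"
  shows "\<exists>j (C :: 'a set). (j, i) \<in> level_less \<and> le_level j C \<and> |B| <o |Pow C|"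
  using assms(1)
proof (cases rule: le_level.cases)
  case countable
  then show ?thesis using assms(2) by blast
next
  case step
  from step[OF assms(3)] show ?thesis .
qed

lemma le_level_ordLeq:
  fixes A A' :: "'a set"
  assumes "le_level i A" "|A'| \<le>o |A|"
  shows "le_level i A'"
proof (cases "countable A")
  case True
  then have "countable A'" using assms(2) countable_ordLeq by blast
  then show ?thesis by (rule le_level.countable)
next
  case False
  show ?thesis
  proof (rule le_level.step)
    fix B :: "'a set" assume "|B| <o |A'|"
    then have "|B| <o |A|" using assms(2) by (rule ordLess_ordLeq_trans)
    then show "\<exists>j (C :: 'a set). (j, i) \<in> level_less \<and> le_level j C \<and> |B| <o |Pow C|"
      using le_level_stepD[OF assms(1) False] by blast
  qed
qed

lemma le_level_mono:
  fixes A :: "'a set"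
  assumes "le_level j A" "(j, i) \<in> level_less"
  shows "le_level i A"
proof (cases "countable A")
  case True
  then show ?thesis by (rule le_level.countable)
next
  case False
  then show ?thesis
    using le_level_stepD[OF assms(1) False] level_less_trans[OF _ assms(2)]
    by (intro le_level.step) blast
qed

text \<open>For an uncountable set the step clause, applied to the empty set, provides a predecessor
  of \<open>i\<close>, and only members of \<open>levels\<close> have predecessors.\<close>

lemma uncountable_le_level:
  fixes A :: "'a set"
  assumes "le_level i A" "uncountable A"
  shows "i \<in> levels"
proof -
  have "|{} :: 'a set| <o |A|"
    by (rule card_of_finite_less_infinite) (use assms(2) countable_finite in auto)
  then show ?thesis using le_level_stepD[OF assms] level_less_levels by blast
qed

text \<open>The least level that bounds \<open>A\<close>. It is unique for uncountable
  \<open>A\<close> only: a countable set has every level without predecessors in this sense.\<close>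

definition has_level :: "nat set option \<Rightarrow> 'a set \<Rightarrow> bool" where
  "has_level i A \<longleftrightarrow> le_level i A \<and> (\<forall>j. (j, i) \<in> level_less \<longrightarrow> \<not> le_level j A)"

lemma has_level_exists:
  assumes "le_level i A" "uncountable A"
  shows "\<exists>j. has_level j A \<and> (j = i \<or> (j, i) \<in> level_less)"
proof -
  obtain j where j: "le_level j A" "\<And>k. (k, j) \<in> level_less \<Longrightarrow> \<not> le_level k A"
    using wfE_min[OF wf_level_less, of i "{i. le_level i A}"] assms(1) by (metis mem_Collect_eq)
  moreover have "j \<in> levels" "i \<in> levels" using uncountable_le_level assms j(1) by blast+
  then have "j = i \<or> (j, i) \<in> level_less" using level_less_total j(2) assms(1) by blast
  ultimately show ?thesis unfolding has_level_def by blast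
qed

lemma has_level_unique:
  assumes "has_level i A" "has_level j A" "uncountable A"
  shows "i = j"
proof -
  have "i \<in> levels" "j \<in> levels"
    using assms uncountable_le_level[of i A] uncountable_le_level[of j A]
    by (simp_all add: has_level_def)
  then show ?thesis using assms level_less_total[of i j] by (auto simp: has_level_def)
qed

lemma has_level_ordIso:
  fixes A B :: "'a set"
  assumes "has_level i A" "|A| =o |B|"
  shows "has_level i B"
proof -
  have "le_level k A \<longleftrightarrow> le_level k B" for k
    using assms(2) le_level_ordLeq[of k A B] le_level_ordLeq[of k B A]
    by (auto simp: ordIso_iff_ordLeq)
  then show ?thesis using assms(1) by (simp add: has_level_def)
qed

lemma countable_le_uncountable:
  assumes "countable A" "infinite B"
  shows "|A| \<le>o |B|"
  using assms infinite_iff_card_of_nat[of B] countable_card_of_nat[of A]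
    ordLeq_transitive[of "|A|" "|UNIV :: nat set|" "|B|"] by blast

section \<open>Agreement of the levels with the beth numbers\<close>

text \<open>\<open>M\<close> is a copy of the beth number at \<open>i\<close>, for which
  \<open>A\<close> guarantees the room. It is chosen as a least upper bound of the sets of level
  \<open>i\<close>. A set smaller than \<open>M\<close> is no upper bound, so it is smaller than
  some set of that level and inherits the step clause from it.\<close>

lemma le_level_max_exists:
  fixes A :: "'a set"
  assumes inf: "infinite A" and bound: "\<And>C :: 'a set. le_level i C \<Longrightarrow> |C| \<le>o |A|"
  shows "\<exists>M :: 'a set. le_level i M \<and> (\<forall>C :: 'a set. le_level i C \<longrightarrow> |C| \<le>o |M| )"
proof -
  define U :: "'a set set" where "U = {D. \<forall>C :: 'a set. le_level i C \<longrightarrow> |C| \<le>o |D| }"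
  have "A \<in> U" using bound by (simp add: U_def)
  then have "\<exists>r\<in>card_of ` U. \<forall>r'\<in>card_of ` U. r \<le>o r'"
    using card_of_Well_order by (intro exists_minim_Well_order) auto
  then obtain M where M: "M \<in> U" "\<And>D. D \<in> U \<Longrightarrow> |M| \<le>o |D|" by blast
  obtain N where N: "N \<subseteq> A" "countable N" "infinite N"
    using infinite_countable_subset'[OF inf] by blast
  have "le_level i M"
  proof (cases "countable M")
    case True
    then show ?thesis by (rule le_level.countable)
  next
    case False
    show ?thesis
    proof (rule le_level.step)
      fix B :: "'a set" assume B: "|B| <o |M|"
      \<comment> \<open>The step clause can be read off uncountable sets only. If all
        \<open>C\<close> of this level were countable, then \<open>N\<close> would be an upper bound
        and \<open>M\<close> countable.\<close>
      have "\<exists>C :: 'a set. le_level i C \<and> uncountable C \<and> |B| <o |C|"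
      proof (rule ccontr)
        assume neg: "\<not> ?thesis"
        have small: "|C| \<le>o |B|" if "le_level i C" "uncountable C" for C :: "'a set"
          using neg that card_of_less_or_leq[of B C] by blast
        show False
        proof (cases "countable B")
          case True
          have "countable C" if "le_level i C" for C :: "'a set"
            using small[OF that] True countable_ordLeq by blast
          then have "N \<in> U" using countable_le_uncountable N(3) unfolding U_def by blast
          then have "countable M" using M(2) N(2) countable_ordLeq by blast
          with \<open>uncountable M\<close> show False by blast
        next
          case False
          then have "infinite B" using countable_finite by blast
          then have "B \<in> U" using small countable_le_uncountable unfolding U_def by blast
          then show False using M(2) B not_ordLess_ordLeq by blast
        qed
      qed
      then show "\<exists>j (C :: 'a set). (j, i) \<in> level_less \<and> le_level j C \<and> |B| <o |Pow C|"
        using le_level_stepD by blast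
    qed
  qed
  then show ?thesis using M(1) unfolding U_def by blast
qed

text \<open>If this failed, \<open>A\<close> would exceed the sets of all levels, so every level
  would have a largest set \<open>M i\<close>. These sets satisfy the beth recursion; hence
  \<open>|M None|\<close> is the beth number at \<open>omega1\<close> and bounds \<open>|A|\<close>,
  although \<open>M None\<close> is smaller than \<open>A\<close>.\<close>

lemma le_level_None:
  fixes A :: "'a set"
  assumes inf: "infinite A" and le: "le_beth |A| omega1"
  shows "le_level None A"
proof (rule ccontr)
  assume neg: "\<not> le_level None A"
  have less: "|C| <o |A|" if "le_level i C" "i \<in> levels" for i and C :: "'a set"
  proof -
    have "i = None \<or> (i, None) \<in> level_less"
      using that(2) by (auto simp: levels_def level_less_def)
    then have "le_level None C" using that(1) le_level_mono by blast
    then have "\<not> |A| \<le>o |C|" using neg le_level_ordLeq by blast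
    then show ?thesis using card_of_less_or_leq by blast
  qed
  obtain N where N: "N \<subseteq> A" "countable N" "infinite N"
    using infinite_countable_subset'[OF inf] by blast
  have "\<forall>i\<in>levels. \<exists>M :: 'a set. le_level i M \<and> (\<forall>C :: 'a set. le_level i C \<longrightarrow> |C| \<le>o |M| )"
    using le_level_max_exists[OF inf] less ordLess_imp_ordLeq by blast
  from bchoice[OF this] obtain M :: "nat set option \<Rightarrow> 'a set" where
    M': "\<forall>i\<in>levels. le_level i (M i) \<and> (\<forall>C :: 'a set. le_level i C \<longrightarrow> |C| \<le>o |M i| )" by blast
  have M: "le_level i (M i)" "\<And>C :: 'a set. le_level i C \<Longrightarrow> |C| \<le>o |M i|" if "i \<in> levels" for i
    using bspec[OF M' that] by simp_all
  have Minf: "infinite (M i)" if "i \<in> levels" for i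
    using M(2)[OF that le_level.countable[OF N(2)]] N(3) card_of_ordLeq_infinite by blast
  \<comment> \<open>The power set fits into \<open>A\<close>, since otherwise the step clause would
    put \<open>A\<close> at the last level. Its copy \<open>P\<close> has level \<open>i\<close>,
    where \<open>M i\<close> is largest.\<close>
  have Pow: "|Pow (M j)| \<le>o |M i|" if ji: "(j, i) \<in> level_less" for i j
  proof -
    have j: "j \<in> levels" "(j, None) \<in> level_less" and i: "i \<in> levels"
      using level_less_levels[OF ji] by blast+
    have "\<not> |A| <o |Pow (M j)|"
    proof
      assume "|A| <o |Pow (M j)|"
      then have "le_level None A"
        using M(1)[OF j(1)] j(2) ordLess_transitive by (intro le_level.step) blast
      with neg show False by blast
    qed
    then have "|Pow (M j)| \<le>o |A|" using card_of_less_or_leq by blast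
    then obtain P where P: "|Pow (M j)| =o |P|" "P \<subseteq> A"
      using internalize_card_of_ordLeq2[of "Pow (M j)" A] by blast
    have "le_level i P"
    proof (rule le_level.step)
      fix B :: "'a set" assume "|B| <o |P|"
      then have "|B| <o |Pow (M j)|" using P(1) ordIso_symmetric ordLess_ordIso_trans by blast
      then show "\<exists>j (C :: 'a set). (j, i) \<in> level_less \<and> le_level j C \<and> |B| <o |Pow C|"
        using ji M(1)[OF j(1)] by blast
    qed
    then have "|P| \<le>o |M i|" using M(2) i by blast
    then show ?thesis using P(1) ordIso_ordLeq_trans by blast
  qed
  \<comment> \<open>If an upper bound \<open>D\<close> of the powers were smaller than
    \<open>M i\<close>, the step clause would give a power above \<open>D\<close>. The predecessor
    \<open>j\<close> makes \<open>D\<close> infinite, so that \<open>M i\<close> is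
    uncountable.\<close>
  have min: "|M i| \<le>o |D|"
    if i: "i \<in> levels" and j: "(j, i) \<in> level_less" and
      D: "\<And>j. (j, i) \<in> level_less \<Longrightarrow> |Pow (M j)| \<le>o |D|" for i j and D :: "'a set"
  proof (rule ccontr)
    assume neg: "\<not> |M i| \<le>o |D|"
    then have D_less: "|D| <o |M i|" using card_of_less_or_leq by blast
    have "infinite (Pow (M j))" using Minf level_less_levels[OF j] by simp
    then have "infinite D" using D[OF j] card_of_ordLeq_infinite by blast
    then have "uncountable (M i)" using neg countable_le_uncountable by blast
    then obtain k and C :: "'a set" where k: "(k, i) \<in> level_less" "le_level k C" "|D| <o |Pow C|"
      using le_level_stepD[OF M(1)[OF i] _ D_less] by blast
    then have "|Pow C| \<le>o |Pow (M k)|"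
      using M(2)[of k C] level_less_levels[OF k(1)] card_of_Pow_mono[of C "M k"] by blast
    with k(3) have "|D| <o |Pow (M k)|" by (rule ordLess_ordLeq_trans)
    then have "|D| <o |D|" using D[OF k(1)] by (rule ordLess_ordLeq_trans)
    then show False using ordLess_irreflexive by blast
  qed
  \<comment> \<open>A level without predecessors has only countable sets, which gives
    \<open>natLeq\<close>. For the others, \<open>Pow\<close> and \<open>min\<close> are the two
    halves of being the supremum.\<close>
  have beth_M: "beth_value ((\<lambda>j. |M (Some j)| ) ` {j. (Some j, i) \<in> level_less}) |M i|"
    if i: "i \<in> levels" for i
  proof (cases "\<exists>j. (j, i) \<in> level_less")
    case False
    have "countable (M i)"
    proof (rule ccontr)
      assume unc: "uncountable (M i)"
      have "|{} :: 'a set| <o |M i|"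
        by (rule card_of_finite_less_infinite) (use Minf[OF i] in auto)
      then show False using le_level_stepD[OF M(1)[OF i] unc] False by blast
    qed
    then have "|M i| =o |UNIV :: nat set|"
      using Minf[OF i] infinite_iff_card_of_nat[of "M i"] countable_card_of_nat[of "M i"]
      unfolding ordIso_iff_ordLeq by blast
    then have "|M i| =o natLeq" using card_of_nat by (rule ordIso_transitive)
    then show ?thesis using False card_of_Card_order by (auto simp: beth_value_def)
  next
    case True
    then obtain j0 where j0: "(Some j0, i) \<in> level_less"
      using level_lessE by metis
    have cexp: "ctwo ^c |M j| =o |Pow (M j)|" for j
      using card_of_Pow_cexp[of "|M j|"] ordIso_symmetric by (simp only: Field_card_of)
    have "is_card_sup ((\<lambda>c. ctwo ^c c) ` (\<lambda>j. |M (Some j)| ) ` {j. (Some j, i) \<in> level_less}) |M i|"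
      unfolding is_card_sup_def
    proof (intro conjI ballI allI impI card_of_Card_order)
      fix c assume "c \<in> (\<lambda>c. ctwo ^c c) ` (\<lambda>j. |M (Some j)| ) ` {j. (Some j, i) \<in> level_less}"
      then obtain j where j: "c = ctwo ^c |M (Some j)|" "(Some j, i) \<in> level_less" by blast
      show "c \<le>o |M i|" unfolding j(1) by (rule ordIso_ordLeq_trans[OF cexp Pow[OF j(2)]])
    next
      fix d :: "'a rel"
      assume d: "Card_order d \<and>
        (\<forall>c\<in>(\<lambda>c. ctwo ^c c) ` (\<lambda>j. |M (Some j)| ) ` {j. (Some j, i) \<in> level_less}. c \<le>o d)"
      then have iso: "|Field d| =o d" using card_of_Field_ordIso by blast
      have "|Pow (M j)| \<le>o |Field d|" if ji: "(j, i) \<in> level_less" for j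
      proof -
        obtain j' where j': "j = Some j'" using ji by (rule level_lessE)
        have "ctwo ^c |M j| \<le>o d" using d ji unfolding j' by simp
        then have "|Pow (M j)| \<le>o d"
          by (rule ordIso_ordLeq_trans[OF ordIso_symmetric[OF cexp]])
        then show ?thesis by (rule ordLeq_ordIso_trans[OF _ ordIso_symmetric[OF iso]])
      qed
      then have "|M i| \<le>o |Field d|" using min[OF i j0] by blast
      then show "|M i| \<le>o d" using iso by (rule ordLeq_ordIso_trans)
    qed
    then show ?thesis using j0 unfolding beth_value_def by auto
  qed
  have "is_beth omega1 |M None|"
    unfolding is_beth_def
  proof (intro exI[of _ "\<lambda>j. |M (Some j)|"] conjI ballI)
    fix i assume i: "i \<in> Field omega1"
    have "{j. (Some j, Some i) \<in> level_less} = underS omega1 i" by (auto simp: level_less_def)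
    then show "beth_value ((\<lambda>j. |M (Some j)| ) ` underS omega1 i) |M (Some i)|"
      using beth_M[of "Some i"] i by (simp add: levels_def)
  next
    have "{j. (Some j, None) \<in> level_less} = Field omega1" by (auto simp: level_less_def)
    then show "beth_value ((\<lambda>j. |M (Some j)| ) ` Field omega1) |M None|"
      using beth_M[of None] by (simp add: levels_def)
  qed
  then have "|A| \<le>o |M None|" using le unfolding le_beth_def by blast
  then show False using less[OF M(1), of None] not_ordLess_ordLeq by (auto simp: levels_def)
qed

section \<open>Families of trees\<close>

text \<open>An infinite path with constant label, used as an indivisible building block. The path
  makes the group countably infinite.\<close>

definition leaf :: "nat set \<Rightarrow> 'a tree" where
  "leaf A = (\<lambda>s. if s \<in> range (\<lambda>n. replicate n undefined) then Some (Inr A) else None)"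

lemma leaf_Nil [simp]: "leaf A [] = Some (Inr A)"
  by (auto simp: leaf_def intro: range_eqI[of _ _ 0])

lemma leaf_inject: "leaf A = leaf B \<longleftrightarrow> A = B"
  using leaf_Nil by (metis Inr_inject option.inject)

lemma dom_leaf: "dom (leaf A) = range (\<lambda>n. replicate n undefined)"
  by (auto simp: leaf_def dom_def)

lemma infinite_dom_leaf: "infinite (dom (leaf A))"
  unfolding dom_leaf by (rule range_inj_infinite) (metis injI length_replicate)

lemma countable_dom_leaf: "countable (dom (leaf A))"
  by (simp add: dom_leaf)

lemma infinite_range_leaf: "infinite (range leaf)"
proof
  assume "finite (range leaf)"
  then have "finite (UNIV :: nat set set)" by (rule finite_imageD) (simp add: inj_on_def leaf_inject)
  then show False by (simp add: Finite_Set.finite_set)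
qed

lemma card_of_range_leaf: "|range leaf| =o |UNIV :: nat set set|"
  using card_of_ordIsoI[of leaf UNIV "range leaf"] ordIso_symmetric
  by (simp add: bij_betw_def inj_on_def leaf_inject)

text \<open>The result is junk unless \<open>P\<close> has at most as many members as the type \<open>'a\<close>: otherwise there is
  no injective \<open>e\<close>.\<close>

definition graft :: "nat set option \<Rightarrow> 'a tree set \<Rightarrow> 'a tree" where
  "graft i P = (let e = SOME e. inj_on e P in (\<lambda>s. case s of [] \<Rightarrow> Some (Inl i)
     | a # s' \<Rightarrow> (if a \<in> e ` P then inv_into P e a s' else None)))"

lemma graft_Nil [simp]: "graft i P [] = Some (Inl i)"
  by (simp add: graft_def Let_def)

lemma graftE:
  fixes P :: "'a tree set"
  assumes "|P| \<le>o |UNIV :: 'a set|"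
  obtains e where "inj_on e P" "\<And>H s. H \<in> P \<Longrightarrow> graft i P (e H # s) = H s"
    "\<And>a s. graft i P (a # s) \<noteq> None \<Longrightarrow> a \<in> e ` P"
proof -
  define e :: "'a tree \<Rightarrow> 'a" where "e = (SOME e. inj_on e P)"
  have "\<exists>e :: 'a tree \<Rightarrow> 'a. inj_on e P" using assms card_of_ordLeq[of P "UNIV :: 'a set"] by blast
  then have e: "inj_on e P" unfolding e_def by (rule someI_ex)
  have graft: "graft i P (a # s) = (if a \<in> e ` P then inv_into P e a s else None)" for a s
    by (simp add: graft_def e_def Let_def)
  show thesis
  proof (rule that[OF e])
    show "graft i P (e H # s) = H s" if "H \<in> P" for H s
      using that e by (simp add: graft)
    show "graft i P (a # s) \<noteq> None \<Longrightarrow> a \<in> e ` P" for a s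
      by (simp add: graft split: if_splits)
  qed
qed

lemma card_of_dom_graft:
  fixes P :: "'a tree set"
  assumes P: "|P| \<le>o |UNIV :: 'a set|" "infinite P"
    and dom: "\<And>H. H \<in> P \<Longrightarrow> H [] \<noteq> None \<and> |dom H| \<le>o |P|"
  shows "|dom (graft i P)| =o |P|"
proof -
  obtain e where e: "inj_on e P" "\<And>H s. H \<in> P \<Longrightarrow> graft i P (e H # s) = H s"
    "\<And>a s. graft i P (a # s) \<noteq> None \<Longrightarrow> a \<in> e ` P"
    by (rule graftE[OF P(1), of i]) (rule that)
  define Q where "Q = (\<Union>H\<in>P. Cons (e H) ` dom H)"
  have "dom (graft i P) \<subseteq> insert [] Q"
  proof
    fix s assume s: "s \<in> dom (graft i P)"
    show "s \<in> insert [] Q"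
    proof (cases s)
      case (Cons a u)
      then obtain H where H: "H \<in> P" "a = e H" using s e(3)[of a u] by blast
      then have "u \<in> dom H" using s Cons e(2)[of H u] by (simp add: dom_def)
      then show ?thesis using Cons H unfolding Q_def by blast
    qed simp
  qed
  then have sub: "dom (graft i P) \<subseteq> {[]} \<union> Q" by simp
  have "|Cons (e H) ` dom H| \<le>o |P|" if "H \<in> P" for H
    using card_of_image dom[OF that] ordLeq_transitive by blast
  then have "|Q| \<le>o |P|"
    unfolding Q_def using P(2) by (intro card_of_UNION_ordLeq_infinite) (auto simp: card_of_mono1)
  then have "|{[] :: 'a list} <+> Q| \<le>o |{[] :: 'a list} <+> P|" by (rule card_of_Plus_mono2)
  moreover have "|{[] :: 'a list} <+> P| =o |P|"
    using P(2) card_of_singl_ordLeq[of P "[] :: 'a list"]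
    by (intro card_of_Plus_infinite2) auto
  ultimately have "|{[] :: 'a list} <+> Q| \<le>o |P|" by (rule ordLeq_ordIso_trans)
  then have "|{[]} \<union> Q| \<le>o |P|" by (rule ordLeq_transitive[OF card_of_Un_Plus_ordLeq])
  then have "|dom (graft i P)| \<le>o |P|" by (rule ordLeq_transitive[OF card_of_mono1[OF sub]])
  moreover have "|P| \<le>o |dom (graft i P)|"
  proof (rule card_of_ordLeqI)
    show "inj_on (\<lambda>H. [e H]) P" using e(1) by (auto simp: inj_on_def)
    show "[e H] \<in> dom (graft i P)" if "H \<in> P" for H
      using e(2)[OF that, of "[]"] dom[OF that] by (simp add: dom_def)
  qed
  ultimately show ?thesis unfolding ordIso_iff_ordLeq by (rule conjI)
qed

text \<open>The root is related to the root, so the child that carries \<open>H\<close> is related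
  to a child that carries some \<open>K\<close>. The simulation restricts to the subtrees at these
  two children.\<close>

lemma simulates_graftD:
  fixes P Q :: "'a tree set"
  assumes sim: "simulates (graft i Q) (graft i P)"
    and P: "|P| \<le>o |UNIV :: 'a set|" and Q: "|Q| \<le>o |UNIV :: 'a set|"
    and H: "H \<in> P" "H [] \<noteq> None"
  shows "\<exists>K\<in>Q. simulates K H"
proof -
  obtain e where e: "inj_on e P" "\<And>H s. H \<in> P \<Longrightarrow> graft i P (e H # s) = H s"
    "\<And>a s. graft i P (a # s) \<noteq> None \<Longrightarrow> a \<in> e ` P"
    by (rule graftE[OF P, of i]) (rule that)
  obtain d where d: "inj_on d Q" "\<And>H s. H \<in> Q \<Longrightarrow> graft i Q (d H # s) = H s"
    "\<And>a s. graft i Q (a # s) \<noteq> None \<Longrightarrow> a \<in> d ` Q"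
    by (rule graftE[OF Q, of i]) (rule that)
  obtain R where R: "R [] []" "\<And>s t. R s t \<Longrightarrow> graft i P s \<noteq> None \<and> graft i Q t = graft i P s"
    "\<And>s t a. R s t \<Longrightarrow> graft i P (s @ [a]) \<noteq> None \<Longrightarrow> \<exists>b. R (s @ [a]) (t @ [b])"
    using sim unfolding simulates_def by metis
  have "graft i P ([] @ [e H]) \<noteq> None" using e(2)[OF H(1), of "[]"] H(2) by simp
  from R(3)[OF R(1) this] obtain b where b: "R [e H] [b]" by auto
  then have "graft i Q [b] \<noteq> None" using R(2)[OF b] by simp
  then obtain K where K: "K \<in> Q" "b = d K" using d(3) by blast
  define R' where "R' s t = R (e H # s) (d K # t)" for s t
  have "simulates K H"
    unfolding simulates_def
  proof (intro exI[of _ R'] conjI allI impI)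
    show "R' [] []" using b K by (simp add: R'_def)
    show "H s \<noteq> None" "K t = H s" if "R' s t" for s t
      using R(2)[of "e H # s" "d K # t"] that e(2)[OF H(1)] d(2)[OF K(1)] by (simp_all add: R'_def)
    show "\<exists>b. R' (s @ [a]) (t @ [b])" if "R' s t" "H (s @ [a]) \<noteq> None" for s t a
      using R(3)[of "e H # s" "d K # t" a] that e(2)[OF H(1)] by (simp add: R'_def)
  qed
  then show ?thesis using K(1) by blast
qed

text \<open>The members of \<open>P\<close> reappear as the subtrees at the children of the root,
  whatever injection was chosen for the branching.\<close>

lemma graft_eqD:
  fixes P Q :: "'a tree set"
  assumes eq: "graft i P = graft i Q"
    and P: "|P| \<le>o |UNIV :: 'a set|" and Q: "|Q| \<le>o |UNIV :: 'a set|"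
    and Nil: "\<And>H. H \<in> P \<Longrightarrow> H [] \<noteq> None"
  shows "P \<subseteq> Q"
proof
  fix H assume H: "H \<in> P"
  obtain e where e: "inj_on e P" "\<And>H s. H \<in> P \<Longrightarrow> graft i P (e H # s) = H s"
    "\<And>a s. graft i P (a # s) \<noteq> None \<Longrightarrow> a \<in> e ` P"
    by (rule graftE[OF P, of i]) (rule that)
  obtain d where d: "inj_on d Q" "\<And>H s. H \<in> Q \<Longrightarrow> graft i Q (d H # s) = H s"
    "\<And>a s. graft i Q (a # s) \<noteq> None \<Longrightarrow> a \<in> d ` Q"
    by (rule graftE[OF Q, of i]) (rule that)
  have "graft i Q (e H # []) \<noteq> None" using e(2)[OF H, of "[]"] Nil[OF H] by (simp add: eq)
  then obtain K where K: "K \<in> Q" "e H = d K" using d(3) by blast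
  have "H = K"
  proof
    show "H s = K s" for s using e(2)[OF H, of s] d(2)[OF K(1), of s] by (simp add: eq K(2))
  qed
  then show "H \<in> Q" using K(1) by simp
qed

definition antichain :: "'x set \<Rightarrow> 'x set set" where
  "antichain X = (SOME S. (\<forall>P\<in>S. \<forall>Q\<in>S. P \<subseteq> Q \<longrightarrow> P = Q) \<and> (\<forall>P\<in>S. P \<subseteq> X) \<and>
     (\<forall>A. infinite A \<longrightarrow> A \<subseteq> X \<longrightarrow> |{P \<in> S. |P| =o |A| }| =o |Pow A| ))"

lemma antichain:
  assumes "infinite X"
  shows "P \<in> antichain X \<Longrightarrow> Q \<in> antichain X \<Longrightarrow> P \<subseteq> Q \<Longrightarrow> P = Q"
    and "P \<in> antichain X \<Longrightarrow> P \<subseteq> X"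
    and "infinite A \<Longrightarrow> A \<subseteq> X \<Longrightarrow> |{P \<in> antichain X. |P| =o |A| }| =o |Pow A|"
proof -
  have "\<exists>S. (\<forall>P\<in>S. \<forall>Q\<in>S. P \<subseteq> Q \<longrightarrow> P = Q) \<and> (\<forall>P\<in>S. P \<subseteq> X) \<and>
     (\<forall>A. infinite A \<longrightarrow> A \<subseteq> X \<longrightarrow> |{P \<in> S. |P| =o |A| }| =o |Pow A| )"
    by (rule infinite_antichain[OF assms]) (intro exI conjI ballI allI impI, assumption+)
  note spec = someI_ex[OF this, folded antichain_def]
  show "P \<in> antichain X \<Longrightarrow> Q \<in> antichain X \<Longrightarrow> P \<subseteq> Q \<Longrightarrow> P = Q"
    and "P \<in> antichain X \<Longrightarrow> P \<subseteq> X"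
    and "infinite A \<Longrightarrow> A \<subseteq> X \<Longrightarrow> |{P \<in> antichain X. |P| =o |A| }| =o |Pow A|"
    using spec by (simp_all del: Pow_iff)
qed

section \<open>The families by recursion on the stage\<close>

text \<open>Only sets \<open>P\<close> whose size has least level exactly \<open>i\<close> are
  grafted, so different stages yield different cardinalities. The set \<open>A\<close> copies the
  size of \<open>P\<close> to \<open>'a\<close>, where levels are measured and where the branching
  must fit.\<close>

definition family_step :: "(nat set option \<Rightarrow> 'a tree set) \<Rightarrow> nat set option \<Rightarrow> 'a tree set" where
  "family_step F i = graft i ` {P \<in> antichain (range leaf \<union> (\<Union>j\<in>{j. (j, i) \<in> level_less}. F j)).
     \<exists>A :: 'a set. uncountable A \<and> has_level i A \<and> |P| =o |A| }"

definition family :: "nat set option \<Rightarrow> 'a tree set" where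
  "family = wfrec level_less family_step"

definition lower :: "nat set option \<Rightarrow> 'a tree set" where
  "lower i = range leaf \<union> (\<Union>j\<in>{j. (j, i) \<in> level_less}. family j)"

lemma family_unfold:
  "(family i :: 'a tree set) = graft i ` {P \<in> antichain (lower i).
     \<exists>A :: 'a set. uncountable A \<and> has_level i A \<and> |P| =o |A| }"
proof -
  have "(family i :: 'a tree set) = family_step (cut family level_less i) i"
    unfolding family_def by (rule wfrec[OF wf_level_less])
  also have "\<dots> = family_step family i"
    by (simp add: family_step_def cut_apply)
  finally show ?thesis by (simp only: family_step_def lower_def)
qed

lemma infinite_lower: "infinite (lower i)"
  using infinite_range_leaf finite_subset unfolding lower_def by blast

lemma familyE:
  fixes t :: "'a tree"
  assumes "t \<in> family i"
  obtains P and A :: "'a set" where "t = graft i P" "P \<in> antichain (lower i)" "P \<subseteq> lower i"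
    "uncountable A" "has_level i A" "|P| =o |A|" "|P| \<le>o |UNIV :: 'a set|"
proof -
  obtain P and A :: "'a set" where PA: "t = graft i P" "P \<in> antichain (lower i)"
    "uncountable A" "has_level i A" "|P| =o |A|"
    using assms unfolding family_unfold[of i] by blast
  have 1: "P \<subseteq> lower i" using antichain(2)[OF infinite_lower PA(2)] .
  have 2: "|P| \<le>o |UNIV :: 'a set|"
    using PA(5) card_of_mono1[OF subset_UNIV[of A]] by (rule ordIso_ordLeq_trans)
  show thesis using that[OF PA(1,2) 1 PA(3-5) 2] .
qed

lemma family_Nil: "t \<in> family i \<Longrightarrow> t [] = Some (Inl i)"
  by (erule familyE) simp

definition trees :: "'a tree set" where
  "trees = range leaf \<union> (\<Union>i. family i)"

lemma lower_subset_trees: "lower i \<subseteq> trees"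
  unfolding lower_def trees_def by blast

lemma trees_Nil: "t \<in> trees \<Longrightarrow> t [] \<noteq> None"
  using family_Nil unfolding trees_def by fastforce

lemma simulates_Nil: "simulates K H \<Longrightarrow> K [] = H []"
  unfolding simulates_def by blast

text \<open>The root label is preserved. It determines a leaf completely and otherwise tells the
  family, which leaves two members of one family to compare. This case is a premise so that an
  induction hypothesis can supply it.\<close>

lemma simulates_treesI:
  assumes fam: "\<And>i. H \<in> family i \<Longrightarrow> K \<in> family i \<Longrightarrow> H = K"
    and HK: "H \<in> trees" "K \<in> trees" "simulates K H"
  shows "H = K"
proof -
  consider A where "H = leaf A" | i where "H \<in> family i" using HK(1) by (auto simp: trees_def)
  then show ?thesis
  proof cases
    case (1 A)
    then have "K [] = Some (Inr A)" using simulates_Nil[OF HK(3)] by simp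
    then show ?thesis using HK(2) 1 family_Nil by (fastforce simp: trees_def)
  next
    case (2 i)
    then have "K [] = Some (Inl i)" using simulates_Nil[OF HK(3)] family_Nil by metis
    then have "K \<in> family i" using HK(2) family_Nil by (fastforce simp: trees_def)
    then show ?thesis using fam 2 by blast
  qed
qed

text \<open>A simulation between grafts sends each member of \<open>P\<close> to a member of
  \<open>Q\<close> that simulates it, and by induction the two are equal. So \<open>P\<close> is a
  subset of \<open>Q\<close>, and both belong to an antichain.\<close>

lemma simulates_family_eq:
  fixes H K :: "'a tree"
  shows "H \<in> family i \<Longrightarrow> K \<in> family i \<Longrightarrow> simulates K H \<Longrightarrow> H = K"
proof (induction i arbitrary: H K rule: wf_induct_rule[OF wf_level_less])
  case (1 i)
  obtain P A where P: "H = graft i P" "P \<in> antichain (lower i)" "P \<subseteq> lower i"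
    "|P| \<le>o |UNIV :: 'a set|" using familyE[OF 1(2)] by metis
  obtain Q B where Q: "K = graft i Q" "Q \<in> antichain (lower i)" "Q \<subseteq> lower i"
    "|Q| \<le>o |UNIV :: 'a set|" using familyE[OF 1(3)] by metis
  have "P \<subseteq> Q"
  proof
    fix H' assume H': "H' \<in> P"
    then have H'_lower: "H' \<in> lower i" using P(3) by blast
    then have "H' [] \<noteq> None" using lower_subset_trees trees_Nil by blast
    then obtain K' where K': "K' \<in> Q" "simulates K' H'"
      using simulates_graftD[OF 1(4)[unfolded P(1) Q(1)] P(4) Q(4) H'] by blast
    then have K'_lower: "K' \<in> lower i" using Q(3) by blast
    have "H' = K'"
    proof (rule simulates_treesI)
      show "H' \<in> trees" "K' \<in> trees" using H'_lower K'_lower lower_subset_trees by blast+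
      show "simulates K' H'" by (rule K'(2))
      fix j assume j: "H' \<in> family j" "K' \<in> family j"
      then have "(j, i) \<in> level_less"
        using H'_lower family_Nil[OF j(1)] family_Nil by (fastforce simp: lower_def)
      then show "H' = K'" using 1(1) j K'(2) by blast
    qed
    then show "H' \<in> Q" using K'(1) by blast
  qed
  then have "P = Q" using antichain(1)[OF infinite_lower P(2) Q(2)] by blast
  then show ?case using P(1) Q(1) by simp
qed

lemma simulates_trees_eq:
  assumes "H \<in> trees" "K \<in> trees" "simulates K H"
  shows "H = K"
  using simulates_treesI[OF _ assms] simulates_family_eq[OF _ _ assms(3)] by blast

text \<open>A tree of an earlier stage \<open>j\<close> is smaller than \<open>A\<close>, as
  \<open>A\<close> does not have level \<open>j\<close>; so the grafted trees have at most
  \<open>|P|\<close> vertices each.\<close>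

lemma card_of_dom_family_graft:
  fixes A :: "'a set" and P :: "'a tree set"
  assumes "P \<subseteq> lower i" "uncountable A" "has_level i A" "|P| =o |A|"
    and IH: "\<And>j t. (j, i) \<in> level_less \<Longrightarrow> (t :: 'a tree) \<in> family j \<Longrightarrow>
      \<exists>C :: 'a set. uncountable C \<and> has_level j C \<and> |dom t| =o |C|"
  shows "|dom (graft i P)| =o |A|"
proof -
  have inf: "infinite P"
    using assms(2,4) card_of_ordIso_finite countable_finite by blast
  have AP: "|A| \<le>o |P|" using assms(4) by (simp add: ordIso_iff_ordLeq)
  have "|dom (graft i P)| =o |P|"
  proof (rule card_of_dom_graft[OF _ inf])
    show "|P| \<le>o |UNIV :: 'a set|"
      using assms(4) card_of_mono1[OF subset_UNIV[of A]] by (rule ordIso_ordLeq_trans)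
    fix H assume "H \<in> P"
    then have H: "H \<in> lower i" using assms(1) by blast
    have "|dom H| \<le>o |P|"
    proof (cases "H \<in> range leaf")
      case True
      then have "countable (dom H)" using countable_dom_leaf by blast
      then show ?thesis using inf by (rule countable_le_uncountable)
    next
      case False
      then obtain j where j: "(j, i) \<in> level_less" "H \<in> family j"
        using H by (auto simp: lower_def)
      then obtain C :: "'a set" where C: "has_level j C" "|dom H| =o |C|" using IH by blast
      have "\<not> |A| \<le>o |C|"
        using C(1) assms(3) j(1) le_level_ordLeq[of j C A] by (auto simp: has_level_def)
      then have "|C| \<le>o |A|" using card_of_less_or_leq ordLess_imp_ordLeq by blast
      then have "|C| \<le>o |P|" using AP by (rule ordLeq_transitive)
      then show ?thesis by (rule ordIso_ordLeq_trans[OF C(2)])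
    qed
    moreover have "H [] \<noteq> None" using H lower_subset_trees trees_Nil by blast
    ultimately show "H [] \<noteq> None \<and> |dom H| \<le>o |P|" by blast
  qed
  then show ?thesis using assms(4) by (rule ordIso_transitive)
qed

lemma card_of_dom_family:
  fixes t :: "'a tree"
  shows "t \<in> family i \<Longrightarrow> \<exists>A :: 'a set. uncountable A \<and> has_level i A \<and> |dom t| =o |A|"
proof (induction i arbitrary: t rule: wf_induct_rule[OF wf_level_less])
  case (1 i)
  obtain P and A :: "'a set" where P: "t = graft i P" "P \<subseteq> lower i"
    "uncountable A" "has_level i A" "|P| =o |A|" using familyE[OF 1(2)] by metis
  then have "|dom t| =o |A|" using card_of_dom_family_graft[OF P(2-5) 1(1)] by simp
  then show ?case using P(3,4) by blast
qed

text \<open>The trees of size \<open>|A|\<close> are the grafts of the antichain members of that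
  size. There are \<open>2 ^ |A|\<close> of these once \<open>lower i\<close> has a subset of size
  \<open>|A|\<close>.\<close>

lemma card_of_family:
  fixes A :: "'a set"
  shows "uncountable A \<Longrightarrow> has_level i A \<Longrightarrow> |{t \<in> (family i :: 'a tree set). |dom t| =o |A| }| =o |Pow A|"
proof (induction i arbitrary: A rule: wf_induct_rule[OF wf_level_less])
  case (1 i)
  let ?X = "lower i :: 'a tree set"
  \<comment> \<open>Otherwise \<open>?X\<close> would be smaller than some \<open>2 ^ |C|\<close>
    with \<open>C\<close> of an earlier level. But it already contains that many trees: the leaves
    if \<open>C\<close> is countable, and else the trees of size \<open>|C|\<close> by
    induction.\<close>
  have "|A| \<le>o |?X|"
  proof (rule ccontr)
    assume "\<not> |A| \<le>o |?X|"
    then have "|?X| <o |A|" using card_of_less_or_leq by blast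
    then obtain B where B: "B \<subseteq> A" "|?X| =o |B|"
      using internalize_card_of_ordLeq2[of ?X A] ordLess_imp_ordLeq by blast
    then have "|B| <o |A|"
      using \<open>|?X| <o |A|\<close> ordIso_symmetric ordIso_ordLess_trans by blast
    then obtain j and C :: "'a set" where j: "(j, i) \<in> level_less" "le_level j C" "|B| <o |Pow C|"
      using le_level_stepD[of i A B] 1(2,3) unfolding has_level_def by blast
    have "|Pow C| \<le>o |?X|"
    proof (cases "countable C")
      case True
      then have "|Pow C| \<le>o |Pow (UNIV :: nat set)|"
        by (intro card_of_Pow_mono) (simp add: countable_card_of_nat)
      also have "|Pow (UNIV :: nat set)| =o |range leaf :: 'a tree set|"
        using card_of_range_leaf ordIso_symmetric by (simp only: Pow_UNIV)
      also have "|range leaf :: 'a tree set| \<le>o |?X|"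
        by (rule card_of_mono1) (simp add: lower_def)
      finally show ?thesis .
    next
      case False
      \<comment> \<open>The induction hypothesis counts trees at the least level of
        \<open>C\<close>, which may lie below \<open>j\<close>.\<close>
      then obtain m where m: "has_level m C" "m = j \<or> (m, j) \<in> level_less"
        using has_level_exists[OF j(2)] by blast
      then have mi: "(m, i) \<in> level_less" using j(1) level_less_trans by blast
      have "|Pow C| =o |{t \<in> (family m :: 'a tree set). |dom t| =o |C| }|"
        using 1(1)[OF mi False m(1)] by (rule ordIso_symmetric)
      also have "|{t \<in> (family m :: 'a tree set). |dom t| =o |C| }| \<le>o |?X|"
        by (rule card_of_mono1) (use mi in \<open>auto simp: lower_def\<close>)
      finally show ?thesis .
    qed
    with j(3) have "|B| <o |?X|" by (rule ordLess_ordLeq_trans)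
    then have "|B| <o |B|" using B(2) by (rule ordLess_ordIso_trans)
    then show False using ordLess_irreflexive by blast
  qed
  then obtain Y where Y: "Y \<subseteq> ?X" "|A| =o |Y|"
    using internalize_card_of_ordLeq2[of A ?X] by blast
  have Yinf: "infinite Y"
    using Y(2) 1(2) card_of_ordIso_finite countable_finite by blast
  have YA: "|Y| =o |A|" using Y(2) by (rule ordIso_symmetric)
  have "{t \<in> (family i :: 'a tree set). |dom t| =o |A| } = graft i ` {P \<in> antichain ?X. |P| =o |Y| }"
  proof (intro equalityI subsetI)
    fix t :: "'a tree" assume t: "t \<in> {t \<in> family i. |dom t| =o |A| }"
    then have "t \<in> family i" by blast
    then obtain P and B :: "'a set" where P: "t = graft i P" "P \<in> antichain ?X" "P \<subseteq> ?X"
      "uncountable B" "has_level i B" "|P| =o |B|" by (rule familyE)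
    have "|dom t| =o |B|"
      unfolding P(1) by (rule card_of_dom_family_graft[OF P(3-6) card_of_dom_family])
    then have "|B| =o |dom t|" by (rule ordIso_symmetric)
    moreover have "|dom t| =o |A|" using t by blast
    ultimately have "|B| =o |A|" by (rule ordIso_transitive)
    then have "|B| =o |Y|" using Y(2) by (rule ordIso_transitive)
    with P(6) have "|P| =o |Y|" by (rule ordIso_transitive)
    then show "t \<in> graft i ` {P \<in> antichain ?X. |P| =o |Y| }" using P(1,2) by blast
  next
    fix t :: "'a tree" assume "t \<in> graft i ` {P \<in> antichain ?X. |P| =o |Y| }"
    then obtain P where P: "t = graft i P" "P \<in> antichain ?X" "|P| =o |Y|" by blast
    have PA: "|P| =o |A|" using P(3) YA by (rule ordIso_transitive)
    have "P \<subseteq> ?X" using antichain(2)[OF infinite_lower P(2)] .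
    then have "|dom t| =o |A|"
      unfolding P(1) by (rule card_of_dom_family_graft[OF _ 1(2,3) PA card_of_dom_family])
    moreover have "t \<in> family i" using P(1,2) PA 1(2,3) unfolding family_unfold[of i] by blast
    ultimately show "t \<in> {t \<in> family i. |dom t| =o |A| }" by blast
  qed
  moreover have "inj_on (graft i) {P \<in> antichain ?X. |P| =o |Y| }"
  proof (rule inj_onI)
    have small: "|P| \<le>o |UNIV :: 'a set|" if "|P| =o |Y|" for P :: "'a tree set"
      using ordIso_transitive[OF that YA] card_of_mono1[OF subset_UNIV[of A]]
      by (rule ordIso_ordLeq_trans)
    fix P Q assume PQ: "P \<in> {P \<in> antichain ?X. |P| =o |Y| }" "Q \<in> {P \<in> antichain ?X. |P| =o |Y| }"
      "graft i P = graft i Q"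
    have "H [] \<noteq> None" if "H \<in> P" for H
      using that antichain(2)[OF infinite_lower, of P i] PQ(1) lower_subset_trees trees_Nil by blast
    then have "P \<subseteq> Q" using graft_eqD[OF PQ(3)] PQ(1,2) small by blast
    then show "P = Q" using antichain(1)[OF infinite_lower, of P i Q] PQ(1,2) by blast
  qed
  ultimately have "|{t \<in> (family i :: 'a tree set). |dom t| =o |A| }| =o |{P \<in> antichain ?X. |P| =o |Y| }|"
    using ordIso_symmetric[OF card_of_ordIsoI[OF inj_on_imp_bij_betw]] by simp
  also have "|{P \<in> antichain ?X. |P| =o |Y| }| =o |Pow Y|"
    by (rule antichain(3)[OF infinite_lower Yinf Y(1)])
  also have "|Pow Y| =o |Pow A|" using YA by (rule card_of_Pow_cong)
  finally show ?case .
qed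

text \<open>Countable trees are precisely the leaves. An uncountable size has a unique least level,
  and only the family of that level contributes.\<close>

lemma card_of_trees:
  fixes A :: "'a set"
  assumes A: "infinite A" "le_level None A"
  shows "|{t \<in> (trees :: 'a tree set). |dom t| =o |A| }| =o |Pow A|"
proof (cases "countable A")
  case True
  have nat: "|A| =o |UNIV :: nat set|"
    using True A(1) countable_card_of_nat[of A] infinite_iff_card_of_nat[of A]
    unfolding ordIso_iff_ordLeq by blast
  have "{t \<in> (trees :: 'a tree set). |dom t| =o |A| } = range leaf"
  proof (intro equalityI subsetI)
    fix t :: "'a tree" assume t: "t \<in> {t \<in> trees. |dom t| =o |A| }"
    show "t \<in> range leaf"
    proof (rule ccontr)
      assume "t \<notin> range leaf"
      then obtain i where "t \<in> family i" using t by (auto simp: trees_def)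
      then obtain B :: "'a set" where B: "uncountable B" "|dom t| =o |B|"
        using card_of_dom_family by blast
      have "|dom t| =o |A|" using t by blast
      then have "|B| =o |A|" by (rule ordIso_transitive[OF ordIso_symmetric[OF B(2)]])
      then have "countable B" using True countable_ordLeq ordIso_imp_ordLeq by blast
      with B(1) show False by blast
    qed
  next
    fix t :: "'a tree" assume t: "t \<in> range leaf"
    then have "infinite (dom t)" "countable (dom t)"
      using infinite_dom_leaf countable_dom_leaf by blast+
    then have "|dom t| =o |UNIV :: nat set|"
      using countable_card_of_nat[of "dom t"] infinite_iff_card_of_nat[of "dom t"]
      unfolding ordIso_iff_ordLeq by blast
    then have "|dom t| =o |A|" by (rule ordIso_transitive[OF _ ordIso_symmetric[OF nat]])
    then show "t \<in> {t \<in> trees. |dom t| =o |A| }" using t by (auto simp: trees_def)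
  qed
  then have "|{t \<in> (trees :: 'a tree set). |dom t| =o |A| }| =o |Pow (UNIV :: nat set)|"
    using card_of_range_leaf by (simp only: Pow_UNIV)
  then show ?thesis
    by (rule ordIso_transitive[OF _ card_of_Pow_cong[OF ordIso_symmetric[OF nat]]])
next
  case False
  then obtain i where i: "has_level i A" using has_level_exists[OF A(2)] by blast
  have "{t \<in> (trees :: 'a tree set). |dom t| =o |A| } = {t \<in> family i. |dom t| =o |A| }"
  proof (intro equalityI subsetI)
    fix t :: "'a tree" assume t: "t \<in> {t \<in> trees. |dom t| =o |A| }"
    then have tA: "|dom t| =o |A|" by blast
    have "t \<notin> range leaf"
    proof
      assume "t \<in> range leaf"
      then have "countable (dom t)" using countable_dom_leaf by blast
      then have "countable A"
        using tA countable_ordLeq ordIso_imp_ordLeq[OF ordIso_symmetric[OF tA]] by blast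
      with False show False by blast
    qed
    then obtain j where j: "t \<in> family j" using t by (auto simp: trees_def)
    then obtain B :: "'a set" where B: "has_level j B" "|dom t| =o |B|"
      using card_of_dom_family by blast
    have "|B| =o |A|" using ordIso_symmetric[OF B(2)] tA by (rule ordIso_transitive)
    then have "has_level j A" using has_level_ordIso[OF B(1)] by blast
    then have "j = i" using has_level_unique i False by blast
    then show "t \<in> {t \<in> family i. |dom t| =o |A| }" using j tA by blast
  qed (auto simp: trees_def)
  then show ?thesis using card_of_family[OF False i] by simp
qed

lemma infinite_dom_trees:
  assumes "t \<in> trees"
  shows "infinite (dom t)"
proof (cases "t \<in> range leaf")
  case True
  then show ?thesis using infinite_dom_leaf by blast
next
  case False
  then obtain i where "t \<in> family i" using assms by (auto simp: trees_def)
  then obtain A :: "'a set" where "uncountable A" "|dom t| =o |A|"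
    using card_of_dom_family by blast
  then show ?thesis using card_of_ordIso_finite countable_finite by blast
qed

lemma card_of_dom_trees:
  fixes t :: "'a tree"
  assumes "t \<in> trees" and inf: "infinite (UNIV :: 'a set)"
  shows "|dom t| \<le>o |UNIV :: 'a set|"
proof (cases "t \<in> range leaf")
  case True
  then have "countable (dom t)" using countable_dom_leaf by blast
  then show ?thesis using inf by (rule countable_le_uncountable)
next
  case False
  then obtain i where "t \<in> family i" using assms by (auto simp: trees_def)
  then obtain A :: "'a set" where "|dom t| =o |A|"
    using card_of_dom_family by blast
  then show ?thesis using card_of_mono1[OF subset_UNIV[of A]] by (rule ordIso_ordLeq_trans)
qed

section \<open>Transport of groups along injections\<close>

text \<open>Tree groups consist of functions on lists; an injection of the carrier moves them to the
  type \<open>'a\<close> on which the cardinals are given.\<close>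

definition transport :: "('b \<Rightarrow> 'a) \<Rightarrow> 'b monoid \<Rightarrow> 'a monoid" where
  "transport g G = \<lparr>carrier = g ` carrier G,
     monoid.mult = (\<lambda>a b. g (inv_into (carrier G) g a \<otimes>\<^bsub>G\<^esub> inv_into (carrier G) g b)),
     one = g \<one>\<^bsub>G\<^esub>\<rparr>"

context
  fixes g :: "'b \<Rightarrow> 'a" and G :: "'b monoid"
  assumes G: "group G" and g: "inj_on g (carrier G)"
begin

lemma transport_simps:
  "carrier (transport g G) = g ` carrier G"
  "x \<in> carrier G \<Longrightarrow> y \<in> carrier G \<Longrightarrow> g x \<otimes>\<^bsub>transport g G\<^esub> g y = g (x \<otimes>\<^bsub>G\<^esub> y)"
  "\<one>\<^bsub>transport g G\<^esub> = g \<one>\<^bsub>G\<^esub>"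
  using g by (auto simp: transport_def)

lemma group_transport: "group (transport g G)"
proof -
  interpret group G by (rule G)
  show ?thesis
  proof (rule groupI)
    fix x assume "x \<in> carrier (transport g G)"
    then obtain a where a: "x = g a" "a \<in> carrier G" by (auto simp: transport_simps)
    then have "g (inv\<^bsub>G\<^esub> a) \<otimes>\<^bsub>transport g G\<^esub> x = \<one>\<^bsub>transport g G\<^esub>"
      by (simp add: transport_simps)
    then show "\<exists>y\<in>carrier (transport g G). y \<otimes>\<^bsub>transport g G\<^esub> x = \<one>\<^bsub>transport g G\<^esub>"
      using a by (auto simp: transport_simps(1))
  qed (auto simp: transport_simps m_assoc)
qed

lemma torsion_free_transport:
  assumes "torsion_free G"
  shows "torsion_free (transport g G)"
proof -
  interpret group G by (rule G)
  have pow: "g a [^]\<^bsub>transport g G\<^esub> (n::nat) = g (a [^]\<^bsub>G\<^esub> n)" if "a \<in> carrier G" for a n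
    by (induction n) (use that in \<open>simp_all add: nat_pow_def transport_simps flip: nat_pow_def\<close>)
  show ?thesis
    unfolding torsion_free_def
  proof (intro ballI allI impI)
    fix x and n :: nat
    assume "x \<in> carrier (transport g G)" and n: "n > 0 \<and> x [^]\<^bsub>transport g G\<^esub> n = \<one>\<^bsub>transport g G\<^esub>"
    then obtain a where a: "x = g a" "a \<in> carrier G" by (auto simp: transport_simps)
    then have "a [^]\<^bsub>G\<^esub> n = \<one>\<^bsub>G\<^esub>"
      using n pow inj_onD[OF g] by (auto simp: transport_simps)
    then have "a = \<one>\<^bsub>G\<^esub>" using assms a(2) n by (auto simp: torsion_free_def)
    then show "x = \<one>\<^bsub>transport g G\<^esub>" by (simp add: a(1) transport_simps)
  qed
qed

end

lemma mon_transport: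
  assumes G: "group G" "inj_on g (carrier G)" and H: "group H" "inj_on h (carrier H)"
    and f: "f \<in> mon (transport g G) (transport h H)"
  shows "(\<lambda>x. inv_into (carrier H) h (f (g x))) \<in> mon G H"
proof -
  interpret G: group G by (rule G(1))
  interpret H: group H by (rule H(1))
  let ?f = "\<lambda>x. inv_into (carrier H) h (f (g x))"
  have f_mem: "f (g x) \<in> h ` carrier H" if "x \<in> carrier G" for x
    using f that by (auto simp: mon_def hom_def transport_simps[OF G] transport_simps[OF H])
  then have mem: "?f x \<in> carrier H" and h: "h (?f x) = f (g x)" if "x \<in> carrier G" for x
    using that by (simp_all add: inv_into_into f_inv_into_f)
  have "?f (x \<otimes>\<^bsub>G\<^esub> y) = ?f x \<otimes>\<^bsub>H\<^esub> ?f y" if xy: "x \<in> carrier G" "y \<in> carrier G" for x y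
  proof -
    have "f (g (x \<otimes>\<^bsub>G\<^esub> y)) = f (g x) \<otimes>\<^bsub>transport h H\<^esub> f (g y)"
      using f xy by (auto simp: mon_def hom_def transport_simps[OF G])
    also have "\<dots> = h (?f x \<otimes>\<^bsub>H\<^esub> ?f y)"
      using transport_simps(2)[OF H mem[OF xy(1)] mem[OF xy(2)]] h xy by simp
    finally show ?thesis using mem xy H(2) by simp
  qed
  moreover have "inj_on ?f (carrier G)"
  proof (rule inj_onI)
    fix x y assume xy: "x \<in> carrier G" "y \<in> carrier G" "?f x = ?f y"
    then have "f (g x) = f (g y)" using h by metis
    then have "g x = g y"
      using f xy by (auto simp: mon_def transport_simps[OF G] dest: inj_onD)
    then show "x = y" using inj_onD[OF G(2)] xy by blast
  qed
  ultimately show ?thesis using mem by (auto simp: mon_def hom_def)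
qed

theorem theorem3:
  shows "\<exists>\<H> :: 'a monoid set.
    (\<forall>G\<in>\<H>. group G \<and> torsion_free G) \<and>
    pairwise (\<lambda>G H. mon G H = {}) \<H> \<and>
    (\<forall>\<kappa> :: 'a rel. Card_order \<kappa> \<and> cinfinite \<kappa> \<and> le_beth \<kappa> omega1 \<longrightarrow>
       |{G \<in> \<H>. |carrier G| =o \<kappa>}| =o ctwo ^c \<kappa>)"
proof (cases "finite (UNIV :: 'a set)")
  case True
  then have "\<not> cinfinite \<kappa>" for \<kappa> :: "'a rel"
    unfolding cinfinite_def using finite_subset[OF subset_UNIV] by blast
  then show ?thesis by (intro exI[of _ "{}"]) simp
next
  case inf: False
  have "\<exists>g :: ('a list \<Rightarrow> rat) \<Rightarrow> 'a. inj_on g (tree_vectors t)" if t: "t \<in> trees" for t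
  proof -
    have "|tree_vectors t| \<le>o |UNIV :: 'a set|"
      using card_of_tree_vectors[OF infinite_dom_trees[OF t]] card_of_dom_trees[OF t inf]
      by (rule ordIso_ordLeq_trans)
    then show ?thesis using card_of_ordLeq[of "tree_vectors t" "UNIV :: 'a set"] by blast
  qed
  then have "\<forall>t\<in>trees. \<exists>g :: ('a list \<Rightarrow> rat) \<Rightarrow> 'a. inj_on g (tree_vectors t)" by blast
  from bchoice[OF this] obtain g :: "'a tree \<Rightarrow> ('a list \<Rightarrow> rat) \<Rightarrow> 'a" where
    g: "\<forall>t\<in>trees. inj_on (g t) (tree_vectors t)" by blast
  have carrier: "carrier (tree_group t) = tree_vectors t" for t :: "'a tree"
    by (simp add: tree_group_def)
  then have inj: "inj_on (g t) (carrier (tree_group t))" if "t \<in> trees" for t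
    using g that by simp
  define grp where "grp t = transport (g t) (tree_group t)" for t
  \<comment> \<open>Stated as equality of trees, this gives both non-embeddability and, through the
    identity embedding, the injectivity of \<open>grp\<close> that is needed for counting.\<close>
  have eq: "s = t" if st: "s \<in> trees" "t \<in> trees" "f \<in> mon (grp s) (grp t)" for s t f
  proof -
    have "simulates t s"
      using mon_transport[OF group_tree_group inj[OF st(1)] group_tree_group inj[OF st(2)]
          st(3)[unfolded grp_def]]
      by (rule simulates_if_mon) (rule trees_Nil[OF st(1)])
    then show ?thesis by (rule simulates_trees_eq[OF st(1,2)])
  qed
  have "inj_on grp trees"
  proof (rule inj_onI)
    fix s t assume st: "s \<in> trees" "t \<in> trees" "grp s = grp t"
    have "id \<in> mon (grp s) (grp s)" by (auto simp: mon_def hom_def)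
    then show "s = t" using eq[OF st(1,2), of id] st(3) by simp
  qed
  have card: "|carrier (grp t)| =o |dom t|" if t: "t \<in> trees" for t
  proof -
    have "carrier (grp t) = g t ` tree_vectors t"
      unfolding grp_def carrier[symmetric] by (rule transport_simps(1)[OF group_tree_group inj[OF t]])
    moreover have "|tree_vectors t| =o |g t ` tree_vectors t|"
      using card_of_ordIsoI[OF inj_on_imp_bij_betw] g t by blast
    ultimately have "|carrier (grp t)| =o |tree_vectors t|" using ordIso_symmetric by simp
    then show ?thesis
      using card_of_tree_vectors[OF infinite_dom_trees[OF t]] by (rule ordIso_transitive)
  qed
  show ?thesis
  proof (intro exI[of _ "grp ` trees"] conjI allI impI)
    show "\<forall>G\<in>grp ` trees. group G \<and> torsion_free G"
      unfolding grp_def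
      using group_transport[OF group_tree_group inj]
        torsion_free_transport[OF group_tree_group inj torsion_free_tree_group] by blast
    show "pairwise (\<lambda>G H. mon G H = {}) (grp ` trees)"
      unfolding pairwise_def using eq by blast
    fix \<kappa> :: "'a rel" assume \<kappa>: "Card_order \<kappa> \<and> cinfinite \<kappa> \<and> le_beth \<kappa> omega1"
    define A where "A = Field \<kappa>"
    have A\<kappa>: "|A| =o \<kappa>" unfolding A_def using \<kappa> by (simp add: card_of_Field_ordIso)
    have A_inf: "infinite A" using \<kappa> by (simp add: A_def cinfinite_def)
    have "le_beth |A| omega1"
      unfolding le_beth_def
    proof (intro allI impI)
      fix b :: "'a rel" assume "is_beth omega1 b"
      then have "\<kappa> \<le>o b" using \<kappa> by (simp add: le_beth_def)
      then show "|A| \<le>o b" by (rule ordIso_ordLeq_trans[OF A\<kappa>])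
    qed
    then have le: "le_level None A" by (rule le_level_None[OF A_inf])
    have "{G \<in> grp ` trees. |carrier G| =o \<kappa>} = grp ` {t \<in> trees. |dom t| =o |A| }"
    proof -
      have "|carrier (grp t)| =o \<kappa> \<longleftrightarrow> |dom t| =o |A|" if t: "t \<in> trees" for t
      proof
        assume "|carrier (grp t)| =o \<kappa>"
        then show "|dom t| =o |A|"
          using ordIso_transitive[OF ordIso_symmetric[OF card[OF t]]]
            ordIso_transitive[OF _ ordIso_symmetric[OF A\<kappa>]] by blast
      next
        assume "|dom t| =o |A|"
        then show "|carrier (grp t)| =o \<kappa>"
          using ordIso_transitive[OF card[OF t]] ordIso_transitive[OF _ A\<kappa>] by blast
      qed
      then show ?thesis by blast
    qed
    moreover have "inj_on grp {t \<in> trees. |dom t| =o |A| }"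
      using \<open>inj_on grp trees\<close> by (rule inj_on_subset) blast
    ultimately have "|{G \<in> grp ` trees. |carrier G| =o \<kappa>}| =o |{t \<in> (trees :: 'a tree set). |dom t| =o |A| }|"
      using ordIso_symmetric[OF card_of_ordIsoI[OF inj_on_imp_bij_betw]] by simp
    also have "|{t \<in> (trees :: 'a tree set). |dom t| =o |A| }| =o |Pow A|"
      by (rule card_of_trees[OF A_inf le])
    also have "|Pow A| =o ctwo ^c \<kappa>"
      unfolding A_def by (rule card_of_Pow_cexp)
    finally show "|{G \<in> grp ` trees. |carrier G| =o \<kappa>}| =o ctwo ^c \<kappa>" .
  qed
qed

end
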